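(* In the group $\mathsf{G}_{Dend}$ of formal series in planar binary trees, the inverse of the series $$\boldsymbol{\Phi}=\sum_{n\geq 1}\ \sum_{[S,T]\in\mathcal{I}_n} T$$ is the series $$\boldsymbol{\Delta}=\sum_{T_1,T_2}(-1)^{t_1+t_2}\,(t_1+1)\;T_1\vee T_2,$$ where the sum runs over all pairs of planar binary trees $T_1,T_2$, including the trivial tree $|$, and $t_i$ denotes the number of internal vertices of $T_i$.
   Context: Planar binary trees have internal vertices of valence $3$, a root at the bottom and leaves at the top. $Y_n$ is the set of planar binary trees with $n\ge1$ internal vertices; $\mathsf{Y}$ is the unique element of $Y_1$; $|$ is the trivial tree with one leaf and no internal vertex. $S\vee T$ is the tree whose bottom internal vertex has left subtree $S$ and right subtree $T$ ($S,T$ possibly trivial). $S/T$ is obtained by identifying the root of $S$ with the leftmost leaf of $T$; $S\backslash T$ by identifying the root of $T$ with the rightmost leaf of $S$. Tamari order on $Y_n$: $S\leq T$ iff one can pass from $S$ to $T$ by a (possibly empty) sequence of replacements of a subtree $A\vee(B\vee C)$ by $(A\vee B)\vee C$ ($A,B,C$ possibly trivial). $\mathcal{I}_n$ is the set of intervals $[S,T]$ ($S\le T$) of $Y_n$. Vector spaces are over a fixed field $K$. The associative product $*$ is defined on trees by $S*T=\sum_{S\backslash T\leq U\leq S/T}U$ (with unit $|$), extended bilinearly. On the span of nontrivial trees, the dendriform products are, for $S=S_1\vee S_2$ and $T=T_1\vee T_2$, $S\prec T=S_1\vee(S_2*T)$ and $S\succ T=(S*T_1)\vee T_2$ (with $\vee$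 extended bilinearly), so that $*=\prec+\succ$ and $(x\succ y)\prec z=x\succ(y\prec z)$; this is the free dendriform algebra on $\mathsf{Y}$. All operations extend to the completed space $\prod_{n\ge1}K Y_n$ of formal series of trees. The dendriform operad $Dend$ (non-symmetric) has $Dend(n)=KY_n$ and unit $\mathsf{Y}$. A tree $T=L\vee R\in Y_n$, where $L$ has $\ell$ internal vertices, acts as the $n$-ary operation $T(a_1,\dots,a_n)=L(a_1,\dots,a_\ell)\succ a_{\ell+1}\prec R(a_{\ell+2},\dots,a_n)$, where the factor involving $L$ (resp. $R$) is omitted if $L=|$ (resp. $R=|$). The group $\mathsf{G}_{Dend}$ is the set of formal series $F=\sum_{n\ge 1}\sum_{T\in Y_n}f_T\,T$ with $f_{\mathsf{Y}}=1$, with product $FG=\sum_{n\ge1}\sum_{T\in Y_n}f_T\,T(G,\dots,G)$ (linear in the left factor $F$) and unit $\mathsf{Y}$. *)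

theory Defs
  imports "HOL-Algebra.Group"
begin

datatype pbt = Triv | Vee pbt pbt

fun nodes :: "pbt \<Rightarrow> nat" where
  "nodes Triv = 0"
| "nodes (Vee L R) = nodes L + nodes R + 1"

definition Y_trees :: "nat \<Rightarrow> pbt set" where
  "Y_trees n = {T. nodes T = n}"

abbreviation Y_tree :: pbt where
  "Y_tree \<equiv> Vee Triv Triv"

text \<open>\<open>graft_over S T\<close> is S/T (the root of S is glued to the leftmost leaf of T), and
  \<open>graft_under S T\<close> is the backslash product (the root of T is glued to the rightmost leaf of S).\<close>

fun graft_over :: "pbt \<Rightarrow> pbt \<Rightarrow> pbt" where
  "graft_over S Triv = S"
| "graft_over S (Vee L R) = Vee (graft_over S L) R"

fun graft_under :: "pbt \<Rightarrow> pbt \<Rightarrow> pbt" where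
  "graft_under Triv T = T"
| "graft_under (Vee L R) T = Vee L (graft_under R T)"

inductive tamari_step :: "pbt \<Rightarrow> pbt \<Rightarrow> bool" where
  rotate: "tamari_step (Vee A (Vee B C)) (Vee (Vee A B) C)"
| left: "tamari_step S S' \<Longrightarrow> tamari_step (Vee S T) (Vee S' T)"
| right: "tamari_step T T' \<Longrightarrow> tamari_step (Vee S T) (Vee S T')"

definition tamari_le :: "pbt \<Rightarrow> pbt \<Rightarrow> bool" (infix "\<le>\<^sub>T" 50) where
  "tamari_le = tamari_step\<^sup>*\<^sup>*"

text \<open>The interval [S,T] is represented by the pair of its end points.\<close>

definition intervals :: "nat \<Rightarrow> (pbt \<times> pbt) set" where
  "intervals n = {(S, T). S \<in> Y_trees n \<and> T \<in> Y_trees n \<and> S \<le>\<^sub>T T}"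

text \<open>A series is its coefficient function. The trivial tree is allowed as an index, so that the
  unit of the associative product is a series too; series supported on nontrivial trees are those
  with \<open>F Triv = 0\<close>.\<close>

type_synonym 'k series = "pbt \<Rightarrow> 'k"

definition of_tree :: "pbt \<Rightarrow> 'k::field series" where
  "of_tree T = (\<lambda>U. if U = T then 1 else 0)"

definition smult_series :: "'k::field \<Rightarrow> 'k series \<Rightarrow> 'k series" where
  "smult_series c F = (\<lambda>U. c * F U)"

text \<open>Coefficientwise sum of a family of series. It is meaningful when every coefficient is nonzero
  for only finitely many members of the family (\<open>summable_family\<close>); this is proved
  for all the families summed in this theory.\<close>

definition formal_sum :: "'a set \<Rightarrow> ('a \<Rightarrow> 'k::field series) \<Rightarrow> 'k series" where
  "formal_sum A f = (\<lambda>U. \<Sum>a\<in>{a \<in> A. f a U \<noteq> 0}. f a U)"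

definition summable_family :: "'a set \<Rightarrow> ('a \<Rightarrow> 'k::field series) \<Rightarrow> bool" where
  "summable_family A f \<longleftrightarrow> (\<forall>U. finite {a \<in> A. f a U \<noteq> 0})"

definition bilinear_ext ::
    "(pbt \<Rightarrow> pbt \<Rightarrow> 'k::field series) \<Rightarrow> 'k series \<Rightarrow> 'k series \<Rightarrow> 'k series" where
  "bilinear_ext b F G = formal_sum UNIV (\<lambda>(S, T). smult_series (F S * G T) (b S T))"

definition star_tree :: "pbt \<Rightarrow> pbt \<Rightarrow> 'k::field series" where
  "star_tree S T = formal_sum {U. graft_under S T \<le>\<^sub>T U \<and> U \<le>\<^sub>T graft_over S T} of_tree"

definition star :: "'k::field series \<Rightarrow> 'k series \<Rightarrow> 'k series" where
  "star = bilinear_ext star_tree"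

definition vee :: "'k::field series \<Rightarrow> 'k series \<Rightarrow> 'k series" where
  "vee = bilinear_ext (\<lambda>S T. of_tree (Vee S T))"

text \<open>The dendriform products are only used for series supported on nontrivial trees. The values
  below at trivial arguments are immaterial.\<close>

fun prec_tree :: "pbt \<Rightarrow> pbt \<Rightarrow> 'k::field series" where
  "prec_tree (Vee S1 S2) T = vee (of_tree S1) (star (of_tree S2) (of_tree T))"
| "prec_tree Triv T = (\<lambda>_. 0)"

fun succ_tree :: "pbt \<Rightarrow> pbt \<Rightarrow> 'k::field series" where
  "succ_tree S (Vee T1 T2) = vee (star (of_tree S) (of_tree T1)) (of_tree T2)"
| "succ_tree S Triv = (\<lambda>_. 0)"

definition dend_prec :: "'k::field series \<Rightarrow> 'k series \<Rightarrow> 'k series" where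
  "dend_prec = bilinear_ext prec_tree"

definition dend_succ :: "'k::field series \<Rightarrow> 'k series \<Rightarrow> 'k series" where
  "dend_succ = bilinear_ext succ_tree"

text \<open>\<open>dend_act T as\<close> is \<open>T(a\<^sub>1,\<dots>,a\<^sub>n)\<close>, for a list \<open>as\<close> of length \<open>n = nodes T \<ge> 1\<close>.
  The trivial tree is not an operation of the operad; its value is a dummy.\<close>

fun dend_act :: "pbt \<Rightarrow> 'k::field series list \<Rightarrow> 'k series" where
  "dend_act Triv as = (\<lambda>_. 0)"
| "dend_act (Vee L R) as =
    (let x = as ! nodes L;
         y = (if R = Triv then x else dend_prec x (dend_act R (drop (nodes L + 1) as)))
     in if L = Triv then y else dend_succ (dend_act L (take (nodes L) as)) y)"

definition dend_comp :: "'k::field series \<Rightarrow> 'k series \<Rightarrow> 'k series" where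
  "dend_comp F G =
    formal_sum (\<Union>n\<in>{1..}. Y_trees n) (\<lambda>T. smult_series (F T) (dend_act T (replicate (nodes T) G)))"

definition G_Dend :: "'k::field series monoid" where
  "G_Dend = \<lparr>carrier = {F. F Triv = 0 \<and> F Y_tree = 1}, mult = dend_comp, one = of_tree Y_tree\<rparr>"

definition Phi :: "'k::field series" where
  "Phi = formal_sum (\<Union>n\<in>{1..}. intervals n) (\<lambda>(S, T). of_tree T)"

definition Delta :: "'k::field series" where
  "Delta = formal_sum UNIV (\<lambda>(T1, T2).
     smult_series ((- 1) ^ (nodes T1 + nodes T2) * of_nat (nodes T1 + 1)) (of_tree (Vee T1 T2)))"

lemma finite_nodes_le: "finite {T. nodes T \<le> n}"
proof (induction n)
  case 0
  have "{T. nodes T \<le> 0} \<subseteq> {Triv}"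
    by (auto elim: nodes.elims)
  then show ?case
    by (rule finite_subset) simp
next
  case (Suc n)
  have "{T. nodes T \<le> Suc n} \<subseteq> insert Triv (case_prod Vee ` ({T. nodes T \<le> n} \<times> {T. nodes T \<le> n}))"
  proof
    fix T assume "T \<in> {T. nodes T \<le> Suc n}"
    then show "T \<in> insert Triv (case_prod Vee ` ({T. nodes T \<le> n} \<times> {T. nodes T \<le> n}))"
      by (cases T) (auto simp: image_iff)
  qed
  then show ?case
    by (rule finite_subset) (use Suc in auto)
qed

lemma nodes_graft [simp]:
  "nodes (graft_over S T) = nodes S + nodes T" "nodes (graft_under S T) = nodes S + nodes T"
proof -
  show "nodes (graft_over S T) = nodes S + nodes T"
    by (induction S T rule: graft_over.induct) auto
  show "nodes (graft_under S T) = nodes S + nodes T"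
    by (induction S T rule: graft_under.induct) auto
qed

lemma tamari_step_nodes: "tamari_step S T \<Longrightarrow> nodes S = nodes T"
  by (induction rule: tamari_step.induct) auto

lemma tamari_le_nodes: "S \<le>\<^sub>T T \<Longrightarrow> nodes S = nodes T"
  unfolding tamari_le_def by (induction rule: rtranclp_induct) (auto dest: tamari_step_nodes)

lemma summable_of_tree: "summable_family A of_tree"
  by (auto simp: summable_family_def of_tree_def intro: finite_subset[of _ "{U}" for U])

lemma formal_sum_of_tree: "formal_sum A of_tree U = (if U \<in> A then 1 else 0)"
proof -
  have "{a \<in> A. of_tree a U \<noteq> (0::'a)} = (if U \<in> A then {U} else {})"
    by (auto simp: of_tree_def)
  then show ?thesis
    by (simp add: formal_sum_def) (simp add: of_tree_def)
qed

lemma formal_sum_nonzeroD: "formal_sum A f U \<noteq> 0 \<Longrightarrow> \<exists>a\<in>A. f a U \<noteq> 0"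
  unfolding formal_sum_def by (metis (mono_tags, lifting) empty_iff mem_Collect_eq subsetI subset_empty sum.empty)

lemma bilinear_ext_nonzeroD:
  "bilinear_ext b F G U \<noteq> 0 \<Longrightarrow> \<exists>S T. F S \<noteq> 0 \<and> G T \<noteq> 0 \<and> b S T U \<noteq> 0"
  unfolding bilinear_ext_def by (drule formal_sum_nonzeroD) (auto simp: smult_series_def)

lemma of_tree_nonzeroD: "of_tree T U \<noteq> 0 \<Longrightarrow> U = T"
  by (auto simp: of_tree_def split: if_splits)

lemma star_tree_nonzeroD: "star_tree S T U \<noteq> 0 \<Longrightarrow> nodes U = nodes S + nodes T"
  unfolding star_tree_def by (auto simp: formal_sum_of_tree split: if_splits dest: tamari_le_nodes)

lemma star_of_tree_nonzeroD:
  "star (of_tree S) (of_tree T) U \<noteq> 0 \<Longrightarrow> nodes U = nodes S + nodes T"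
  unfolding star_def
  by (drule bilinear_ext_nonzeroD) (auto dest!: of_tree_nonzeroD star_tree_nonzeroD)

lemma prec_tree_nonzeroD: "prec_tree S T U \<noteq> 0 \<Longrightarrow> nodes U = nodes S + nodes T"
  by (cases S)
    (auto simp: vee_def dest!: bilinear_ext_nonzeroD star_of_tree_nonzeroD of_tree_nonzeroD)

lemma succ_tree_nonzeroD: "succ_tree S T U \<noteq> 0 \<Longrightarrow> nodes U = nodes S + nodes T"
  by (cases T)
    (auto simp: vee_def dest!: bilinear_ext_nonzeroD star_of_tree_nonzeroD of_tree_nonzeroD)

lemma summable_bilinear_ext:
  assumes "\<And>S T U. b S T U \<noteq> 0 \<Longrightarrow> nodes S + nodes T \<le> nodes U"
  shows "summable_family UNIV (\<lambda>(S, T). smult_series (F S * G T) (b S T))"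
  unfolding summable_family_def
proof
  fix U
  show "finite {a \<in> UNIV. (case a of (S, T) \<Rightarrow> smult_series (F S * G T) (b S T)) U \<noteq> 0}"
    by (rule finite_subset[of _ "{T. nodes T \<le> nodes U} \<times> {T. nodes T \<le> nodes U}"])
      (auto simp: smult_series_def finite_nodes_le dest!: assms)
qed

lemma summable_star: "summable_family UNIV (\<lambda>(S, T). smult_series (F S * G T) (star_tree S T))"
  by (rule summable_bilinear_ext) (auto dest: star_tree_nonzeroD)

lemma summable_vee: "summable_family UNIV (\<lambda>(S, T). smult_series (F S * G T) (of_tree (Vee S T)))"
  by (rule summable_bilinear_ext) (auto dest!: of_tree_nonzeroD)

lemma summable_prec: "summable_family UNIV (\<lambda>(S, T). smult_series (F S * G T) (prec_tree S T))"
  by (rule summable_bilinear_ext) (auto dest: prec_tree_nonzeroD)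

lemma summable_succ: "summable_family UNIV (\<lambda>(S, T). smult_series (F S * G T) (succ_tree S T))"
  by (rule summable_bilinear_ext) (auto dest: succ_tree_nonzeroD)

lemma dend_act_nonzeroD:
  assumes "\<forall>a\<in>set as. a Triv = 0" "length as = nodes T" "dend_act T as U \<noteq> 0"
  shows "nodes T \<le> nodes U"
  using assms
proof (induction T arbitrary: as U)
  case Triv
  then show ?case by simp
next
  case (Vee L R)
  define x where "x = as ! nodes L"
  define y where "y = (if R = Triv then x else dend_prec x (dend_act R (drop (nodes L + 1) as)))"
  have x: "1 \<le> nodes W" if "x W \<noteq> 0" for W
  proof -
    have "x \<in> set as"
      using Vee.prems(2) by (simp add: x_def)
    with Vee.prems(1) that have "W \<noteq> Triv"
      by auto
    then show ?thesis
      by (cases W) auto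
  qed
  have R: "nodes R \<le> nodes W" if "dend_act R (drop (nodes L + 1) as) W \<noteq> 0" for W
    by (rule Vee.IH(2)[OF _ _ that]) (use Vee.prems in \<open>auto dest: in_set_dropD\<close>)
  have L: "nodes L \<le> nodes W" if "dend_act L (take (nodes L) as) W \<noteq> 0" for W
    by (rule Vee.IH(1)[OF _ _ that]) (use Vee.prems in \<open>auto dest: in_set_takeD\<close>)
  have y: "nodes R + 1 \<le> nodes W" if "y W \<noteq> 0" for W
  proof (cases "R = Triv")
    case True
    with that x show ?thesis
      by (auto simp: y_def)
  next
    case False
    with that obtain S T where "x S \<noteq> 0" "dend_act R (drop (nodes L + 1) as) T \<noteq> 0"
      "nodes W = nodes S + nodes T"
      by (auto simp: y_def dend_prec_def dest!: bilinear_ext_nonzeroD prec_tree_nonzeroD)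
    with x R show ?thesis
      by fastforce
  qed
  have act: "dend_act (Vee L R) as = (if L = Triv then y else dend_succ (dend_act L (take (nodes L) as)) y)"
    by (simp add: y_def x_def Let_def)
  show ?case
  proof (cases "L = Triv")
    case True
    have "y U \<noteq> 0"
      using Vee.prems(3) True unfolding act by simp
    from y[OF this] True show ?thesis
      by simp
  next
    case False
    with Vee.prems(3) obtain S T where "dend_act L (take (nodes L) as) S \<noteq> 0" "y T \<noteq> 0"
      "nodes U = nodes S + nodes T"
      by (auto simp only: act dend_succ_def if_False dest!: bilinear_ext_nonzeroD succ_tree_nonzeroD)
    with L y show ?thesis
      by fastforce
  qed
qed

lemma summable_dend_comp:
  assumes "G Triv = 0"
  shows "summable_family (\<Union>n\<in>{1..}. Y_trees n)
    (\<lambda>T. smult_series (F T) (dend_act T (replicate (nodes T) G)))"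
  unfolding summable_family_def
proof
  fix U
  show "finite {T \<in> \<Union>n\<in>{1..}. Y_trees n. smult_series (F T) (dend_act T (replicate (nodes T) G)) U \<noteq> 0}"
    by (rule finite_subset[OF _ finite_nodes_le[of "nodes U"]])
      (use assms in \<open>auto simp: smult_series_def intro!: dend_act_nonzeroD[of "replicate n G" for n]\<close>)
qed

lemma summable_Phi: "summable_family (\<Union>n\<in>{1..}. intervals n) (\<lambda>(S, T). of_tree T)"
  unfolding summable_family_def
proof
  fix U
  show "finite {a \<in> \<Union>n\<in>{1..}. intervals n. (case a of (S, T) \<Rightarrow> of_tree T) U \<noteq> (0::'a)}"
    by (rule finite_subset[of _ "{T. nodes T \<le> nodes U} \<times> {T. nodes T \<le> nodes U}"])
      (auto simp: finite_nodes_le intervals_def Y_trees_def dest!: of_tree_nonzeroD)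
qed

lemma summable_Delta: "summable_family UNIV (\<lambda>(T1, T2).
   smult_series ((- 1) ^ (nodes T1 + nodes T2) * of_nat (nodes T1 + 1)) (of_tree (Vee T1 T2)))"
  unfolding summable_family_def
proof
  fix U
  show "finite {a \<in> UNIV. (case a of (T1, T2) \<Rightarrow> smult_series
      ((- 1) ^ (nodes T1 + nodes T2) * of_nat (nodes T1 + 1)) (of_tree (Vee T1 T2))) U \<noteq> (0::'a)}"
    by (rule finite_subset[of _ "{T. nodes T \<le> nodes U} \<times> {T. nodes T \<le> nodes U}"])
      (auto simp: finite_nodes_le smult_series_def dest!: of_tree_nonzeroD)
qed

end

theory Submission
  imports Defs
begin

text \<open>
  Write \<open>1\<close> for the trivial tree, \<open>Y\<close> for the tree with one vertex, and
  \<open>D T\<close> for the number of trees below \<open>T\<close>. Then \<open>D = 1 + \<Phi>\<close> as a series, and everything follows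
  from two product formulas in the associative algebra of trees:

    \<^item> \<open>\<Phi> = (D * D) \<or> D\<close>;
    \<^item> \<open>\<Delta> = (A * A) \<or> A\<close>, where \<open>A\<close> has coefficient \<open>(-1)\<^sup>t\<close> at a tree with \<open>t\<close> vertices, and \<open>A\<close> is
      the inverse of \<open>1 + Y\<close> for \<open>*\<close>.

  For the first one (\<open>below_Vee\<close> and \<open>card_graft_under_below\<close>), a tree below \<open>L \<or> R\<close> is uniquely
  \<open>P \ (Q \<or> C)\<close> with \<open>P \ Q \<le> L\<close> and \<open>C \<le> R\<close>: going down in the Tamari order pushes the root to the
  right spine, which cuts the left subtree in two. So \<open>D (L \<or> R)\<close> is \<open>D R\<close> times the number of pairs
  with \<open>P \ Q \<le> L\<close>. Cutting \<open>L\<close> between two consecutive vertices, in infix order, gives a pair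
  \<open>(S, T)\<close>, and \<open>P \ Q \<le> L\<close> holds iff \<open>P \<le> S\<close> and \<open>Q \<le> T\<close> for the cut with as many vertices on the
  left as \<open>P\<close> has (\<open>graft_under_le_iff\<close>). The same cuts describe the product, since \<open>L\<close> occurs in
  \<open>S * T\<close> exactly when \<open>(S, T)\<close> is one of them (\<open>star_interval_iff_splits\<close>). Hence the number of pairs
  is the coefficient of \<open>L\<close> in \<open>D * D\<close>. In the second formula, \<open>t + 1\<close> is the number of cuts of a tree
  with \<open>t\<close> vertices.

  Substituting a series \<open>H\<close> for \<open>Y\<close> respects \<open>*\<close> and sends \<open>F \<or> G = F \<succ> Y \<prec> G\<close> to
  \<open>F(H) \<succ> H \<prec> G(H)\<close> (\<open>series_subst_star\<close> and \<open>series_subst_vee\<close>). In particular \<open>A(\<Phi>)\<close> is the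
  inverse of \<open>1 + \<Phi> = D\<close>, so that
  \<open>\<Delta>(\<Phi>) = (A(\<Phi>) * A(\<Phi>)) \<succ> \<Phi> \<prec> A(\<Phi>) = (A(\<Phi>) * A(\<Phi>) * D * D) \<or> (D * A(\<Phi>)) = Y\<close>.
  Conversely the series \<open>x = D(\<Delta>)\<close> satisfies \<open>x = 1 + (x * x * A * A) \<or> (A * x)\<close>, an equation which
  determines \<open>x\<close> degree by degree and which \<open>1 + Y\<close> solves; so \<open>\<Phi>(\<Delta>) = Y\<close>. Finally, if
  \<open>\<Phi>(H) = Y\<close> then \<open>D(H) = 1 + Y\<close>, and the equation for \<open>\<Phi>\<close> becomes
  \<open>Y = ((1 + Y) * (1 + Y)) \<succ> H \<prec> (1 + Y)\<close>; multiplying by the inverses gives \<open>H = \<Delta>\<close>. This is the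
  uniqueness of the inverse.
\<close>

section \<open>The Tamari order\<close>

lemma tamari_le_refl [simp]: "T \<le>\<^sub>T T"
  by (simp add: tamari_le_def)

lemma tamari_le_trans: "S \<le>\<^sub>T T \<Longrightarrow> T \<le>\<^sub>T U \<Longrightarrow> S \<le>\<^sub>T U"
  unfolding tamari_le_def by (rule rtranclp_trans)

lemma tamari_step_le: "tamari_step S T \<Longrightarrow> S \<le>\<^sub>T T"
  by (auto simp: tamari_le_def)

lemma tamari_le_Vee_left: "S \<le>\<^sub>T S' \<Longrightarrow> Vee S T \<le>\<^sub>T Vee S' T"
  unfolding tamari_le_def
  by (induction rule: rtranclp_induct) (auto intro: rtranclp.rtrancl_into_rtrancl tamari_step.left)

lemma tamari_le_Vee_right: "T \<le>\<^sub>T T' \<Longrightarrow> Vee S T \<le>\<^sub>T Vee S T'"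
  unfolding tamari_le_def
  by (induction rule: rtranclp_induct) (auto intro: rtranclp.rtrancl_into_rtrancl tamari_step.right)

lemma tamari_le_Vee: "S \<le>\<^sub>T S' \<Longrightarrow> T \<le>\<^sub>T T' \<Longrightarrow> Vee S T \<le>\<^sub>T Vee S' T'"
  by (meson tamari_le_Vee_left tamari_le_Vee_right tamari_le_trans)

lemma tamari_le_rotate: "Vee A (Vee B C) \<le>\<^sub>T Vee (Vee A B) C"
  by (intro tamari_step_le tamari_step.rotate)

text \<open>A statistic that every rotation increases strictly; it is what makes the Tamari order antisymmetric.\<close>

fun left_weight :: "pbt \<Rightarrow> nat" where
  "left_weight Triv = 0"
| "left_weight (Vee L R) = left_weight L + left_weight R + nodes L"

lemma tamari_step_left_weight: "tamari_step S T \<Longrightarrow> left_weight S < left_weight T"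
  by (induction rule: tamari_step.induct) (auto dest: tamari_step_nodes)

lemma tamari_le_left_weight: "S \<le>\<^sub>T T \<Longrightarrow> S = T \<or> left_weight S < left_weight T"
  unfolding tamari_le_def
  by (induction rule: rtranclp_induct) (auto dest: tamari_step_left_weight)

lemma tamari_le_antisym: "S \<le>\<^sub>T T \<Longrightarrow> T \<le>\<^sub>T S \<Longrightarrow> S = T"
  by (auto dest!: tamari_le_left_weight)

lemma finite_tamari_below: "finite {S. S \<le>\<^sub>T T}"
  by (rule finite_subset[OF _ finite_nodes_le[of "nodes T"]]) (auto dest: tamari_le_nodes)

lemma tamari_le_Triv_iff: "S \<le>\<^sub>T Triv \<longleftrightarrow> S = Triv"
proof
  assume "S \<le>\<^sub>T Triv"
  then show "S = Triv"
    by (cases S) (auto dest: tamari_le_nodes)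
qed simp

lemma graft_under_assoc: "graft_under (graft_under S T) U = graft_under S (graft_under T U)"
  by (induction S) auto

lemma tamari_step_graft_under: "tamari_step P' P \<Longrightarrow> tamari_step (graft_under P' Q) (graft_under P Q)"
  by (induction rule: tamari_step.induct) (auto intro: tamari_step.intros)

lemma tamari_step_graft_under_right:
  "tamari_step Q' Q \<Longrightarrow> tamari_step (graft_under P Q') (graft_under P Q)"
  by (induction P) (auto intro: tamari_step.intros)

text \<open>The rotations that lead into \<open>A \ (B \<or> C)\<close>. Besides those inside \<open>A\<close>, \<open>B\<close> or \<open>C\<close>, there is only
  the one which undoes the rotation at the vertex joining \<open>B\<close> and \<open>C\<close>. A rotation at
  a spine vertex of \<open>A\<close> counts as one inside \<open>A\<close>: it only carries \<open>B \<or> C\<close> along at the end of the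
  right spine.\<close>

lemma tamari_step_into_graft_under_Vee:
  assumes "tamari_step S (graft_under A (Vee B C))"
  shows "(\<exists>A'. tamari_step A' A \<and> S = graft_under A' (Vee B C))
    \<or> (\<exists>B'. tamari_step B' B \<and> S = graft_under A (Vee B' C))
    \<or> (\<exists>C'. tamari_step C' C \<and> S = graft_under A (Vee B C'))
    \<or> (\<exists>B1 B2. B = Vee B1 B2 \<and> S = graft_under A (Vee B1 (Vee B2 C)))"
  using assms
proof (induction A arbitrary: S)
  case Triv
  then show ?case
    by (auto elim: tamari_step.cases)
next
  case (Vee L R)
  from Vee.prems have "tamari_step S (Vee L (graft_under R (Vee B C)))"
    by simp
  then show ?case
  proof cases
    case (rotate L1 L2)
    then have "tamari_step (Vee L1 (Vee L2 R)) (Vee L R)"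
      and "S = graft_under (Vee L1 (Vee L2 R)) (Vee B C)"
      by (auto intro: tamari_step.rotate)
    then show ?thesis
      by blast
  next
    case (left L')
    then have "tamari_step (Vee L' R) (Vee L R)" and "S = graft_under (Vee L' R) (Vee B C)"
      by (auto intro: tamari_step.left)
    then show ?thesis
      by blast
  next
    case (right R')
    from Vee.IH(2)[OF right(2)] show ?thesis
    proof (elim disjE exE conjE)
      fix A' assume "tamari_step A' R" "R' = graft_under A' (Vee B C)"
      then have "tamari_step (Vee L A') (Vee L R)" and "S = graft_under (Vee L A') (Vee B C)"
        using right by (auto intro: tamari_step.right)
      then show ?thesis
        by blast
    next
      fix B' assume "tamari_step B' B" "R' = graft_under R (Vee B' C)"
      then show ?thesis
        using right(1) by (metis graft_under.simps(2))
    next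
      fix C' assume "tamari_step C' C" "R' = graft_under R (Vee B C')"
      then show ?thesis
        using right(1) by (metis graft_under.simps(2))
    next
      fix B1 B2 assume "B = Vee B1 B2" "R' = graft_under R (Vee B1 (Vee B2 C))"
      then show ?thesis
        using right(1) by (metis graft_under.simps(2))
    qed
  qed
qed

lemma graft_under_Vee_le: "graft_under A (Vee B C) \<le>\<^sub>T Vee (graft_under A B) C"
proof (induction A)
  case (Vee L R)
  have "Vee L (graft_under R (Vee B C)) \<le>\<^sub>T Vee L (Vee (graft_under R B) C)"
    by (intro tamari_le_Vee_right Vee.IH)
  from tamari_le_trans[OF this tamari_le_rotate] show ?case
    by simp
qed simp

text \<open>The order ideal below \<open>L \<or> R\<close>. Going down by rotations, the root vertex of \<open>L \<or> R\<close> always stays on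
  the right spine: a downward rotation replaces \<open>A \ B\<close> or \<open>C\<close> by a smaller tree, or else moves
  the border between \<open>A\<close> and \<open>B\<close> without changing \<open>A \ B\<close>.\<close>

lemma tamari_le_Vee_iff:
  "S \<le>\<^sub>T Vee L R \<longleftrightarrow>
    (\<exists>A B C. S = graft_under A (Vee B C) \<and> graft_under A B \<le>\<^sub>T L \<and> C \<le>\<^sub>T R)"
proof
  assume "S \<le>\<^sub>T Vee L R"
  then show "\<exists>A B C. S = graft_under A (Vee B C) \<and> graft_under A B \<le>\<^sub>T L \<and> C \<le>\<^sub>T R"
    unfolding tamari_le_def
  proof (induction rule: converse_rtranclp_induct)
    case base
    have "Vee L R = graft_under Triv (Vee L R)"
      by simp
    then show ?case
      by (metis graft_under.simps(1) rtranclp.rtrancl_refl)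
  next
    case (step S' S)
    then obtain A B C where S: "S = graft_under A (Vee B C)"
      and L: "graft_under A B \<le>\<^sub>T L" and R: "C \<le>\<^sub>T R"
      unfolding tamari_le_def by blast
    have "\<exists>A B C. S' = graft_under A (Vee B C) \<and> graft_under A B \<le>\<^sub>T L \<and> C \<le>\<^sub>T R"
      using tamari_step_into_graft_under_Vee[OF step.hyps(1)[unfolded S]]
    proof (elim disjE exE conjE)
      fix B1 B2 assume B: "B = Vee B1 B2" and S': "S' = graft_under A (Vee B1 (Vee B2 C))"
      \<comment> \<open>The root of \<open>B\<close> joins the spine, and \<open>A\<close> grows by that root and its left subtree.\<close>
      have "S' = graft_under (graft_under A (Vee B1 Triv)) (Vee B2 C)"
        and "graft_under (graft_under A (Vee B1 Triv)) B2 = graft_under A B"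
        by (simp_all add: B S' graft_under_assoc)
      with L R show ?thesis
        by metis
    next
      fix A' assume A': "tamari_step A' A" and S': "S' = graft_under A' (Vee B C)"
      have "graft_under A' B \<le>\<^sub>T L"
        using A' L by (meson tamari_le_trans tamari_step_le tamari_step_graft_under)
      with S' R show ?thesis
        by blast
    next
      fix B' assume B': "tamari_step B' B" and S': "S' = graft_under A (Vee B' C)"
      have "graft_under A B' \<le>\<^sub>T L"
        using B' L by (meson tamari_le_trans tamari_step_le tamari_step_graft_under_right)
      with S' R show ?thesis
        by blast
    next
      fix C' assume C': "tamari_step C' C" and S': "S' = graft_under A (Vee B C')"
      have "C' \<le>\<^sub>T R"
        using C' R by (meson tamari_le_trans tamari_step_le)
      with S' L show ?thesis
        by blast
    qed
    then show ?case
      unfolding tamari_le_def .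
  qed
next
  assume "\<exists>A B C. S = graft_under A (Vee B C) \<and> graft_under A B \<le>\<^sub>T L \<and> C \<le>\<^sub>T R"
  then show "S \<le>\<^sub>T Vee L R"
    by (meson graft_under_Vee_le tamari_le_Vee tamari_le_trans)
qed

section \<open>Splittings and the intervals of the associative product\<close>

text \<open>All ways to cut a tree into a left and a right part along the path from the root to a position
  between two consecutive vertices in infix order (or to one of the two ends). This is
  the coproduct dual to the associative product on trees (\<open>star_interval_iff_splits\<close>).\<close>

fun splits :: "pbt \<Rightarrow> (pbt \<times> pbt) set" where
  "splits Triv = {(Triv, Triv)}"
| "splits (Vee L R) = (\<lambda>(S, T). (S, Vee T R)) ` splits L \<union> (\<lambda>(S, T). (Vee L S, T)) ` splits R"

lemma finite_splits [simp]: "finite (splits U)"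
  by (induction U) auto

lemma splits_nodes: "(S, T) \<in> splits U \<Longrightarrow> nodes S + nodes T = nodes U"
  by (induction U arbitrary: S T) auto

text \<open>A cut is determined by the number of vertices that it leaves on its left.\<close>

lemma splits_unique:
  "(S, T) \<in> splits U \<Longrightarrow> (S', T') \<in> splits U \<Longrightarrow> nodes S = nodes S' \<Longrightarrow> S = S' \<and> T = T'"
proof (induction U arbitrary: S T S' T')
  case (Vee L R)
  from Vee.prems(1) consider
    (left) T1 where "T = Vee T1 R" "(S, T1) \<in> splits L"
  | (right) S1 where "S = Vee L S1" "(S1, T) \<in> splits R"
    by auto
  note S = this
  from Vee.prems(2) consider
    (left') T1' where "T' = Vee T1' R" "(S', T1') \<in> splits L"
  | (right') S1' where "S' = Vee L S1'" "(S1', T') \<in> splits R"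
    by auto
  note S' = this
  show ?case
  proof (rule S; rule S')
    fix T1 S1' assume "(S, T1) \<in> splits L" "S' = Vee L S1'"
    then show ?thesis
      using Vee.prems(3) by (auto dest: splits_nodes)
  next
    fix S1 T1' assume "S = Vee L S1" "(S', T1') \<in> splits L"
    then show ?thesis
      using Vee.prems(3) by (auto dest: splits_nodes)
  next
    fix T1 T1' assume "T = Vee T1 R" "(S, T1) \<in> splits L" "T' = Vee T1' R" "(S', T1') \<in> splits L"
    then show ?thesis
      using Vee.IH(1) Vee.prems(3) by blast
  next
    fix S1 S1' assume "S = Vee L S1" "(S1, T) \<in> splits R" "S' = Vee L S1'" "(S1', T') \<in> splits R"
    then show ?thesis
      using Vee.IH(2) Vee.prems(3) by auto
  qed
qed simp

lemma sum_splits_Vee: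
  "(\<Sum>(S, T)\<in>splits (Vee L R). f S T) =
    (\<Sum>(S, T)\<in>splits L. f S (Vee T R)) + (\<Sum>(S, T)\<in>splits R. f (Vee L S) T)"
proof -
  have disj: "(\<lambda>(S, T). (S, Vee T R)) ` splits L \<inter> (\<lambda>(S, T). (Vee L S, T)) ` splits R = {}"
    by (fastforce dest: splits_nodes)
  have "inj_on (\<lambda>(S, T). (S, Vee T R)) (splits L)" "inj_on (\<lambda>(S, T). (Vee L S, T)) (splits R)"
    by (auto simp: inj_on_def)
  then show ?thesis
    by (simp add: sum.union_disjoint[OF _ _ disj] sum.reindex) (simp add: case_prod_unfold comp_def)
qed

lemma splits_right_Triv: "(S, Triv) \<in> splits U \<longleftrightarrow> S = U"
  by (induction U arbitrary: S) auto

lemma splits_left_Triv: "(Triv, T) \<in> splits U \<longleftrightarrow> T = U"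
  by (induction U arbitrary: T) auto

text \<open>One cut for each position among the vertices in infix order: this is the factor \<open>t + 1\<close> in \<open>\<Delta>\<close>.\<close>

lemma card_splits: "card (splits U) = nodes U + 1"
proof (induction U)
  case (Vee L R)
  have "card (splits (Vee L R)) = (\<Sum>(S, T)\<in>splits (Vee L R). 1)"
    by simp
  then show ?case
    using Vee by (simp only: sum_splits_Vee) simp
qed simp

text \<open>Both sides cut the same right spine, so one of the cuts is the higher one; the two alternatives say
  whether the vertex joining \<open>B\<close> and \<open>C\<close> belongs to \<open>Q\<close> or to \<open>P\<close>.\<close>

lemma graft_under_eq_graft_under_Vee:
  "graft_under P Q = graft_under A (Vee B C) \<longleftrightarrow>
    (\<exists>A'. A = graft_under P A' \<and> Q = graft_under A' (Vee B C))
    \<or> (\<exists>C'. P = graft_under A (Vee B C') \<and> C = graft_under C' Q)"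
    (is "?eq P A \<longleftrightarrow> ?cut P A")
proof
  show "?eq P A \<Longrightarrow> ?cut P A"
  proof (induction P arbitrary: A)
    case (Vee L R)
    show ?case
    proof (cases A)
      case Triv
      with Vee.prems show ?thesis
        by simp
    next
      case A: (Vee L' A2)
      with Vee.prems have "L' = L" "graft_under R Q = graft_under A2 (Vee B C)"
        by simp_all
      from Vee.IH(2)[OF this(2)] show ?thesis
        unfolding A \<open>L' = L\<close> by simp
    qed
  qed simp
next
  show "?cut P A \<Longrightarrow> ?eq P A"
    by (elim disjE exE conjE) (simp_all add: graft_under_assoc)
qed

text \<open>Grafting and cutting are adjoint for the Tamari order. In the induction on \<open>U = L \<or> R\<close>, the tree
  \<open>P \ Q\<close> is written as \<open>A \ (B \<or> C)\<close>; if the root of \<open>U\<close> falls into \<open>Q\<close> then the cut of \<open>U\<close> goes through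
  \<open>L\<close>, and if it falls into \<open>P\<close> then the cut goes through \<open>R\<close>.\<close>

lemma graft_under_le_iff:
  "graft_under P Q \<le>\<^sub>T U \<longleftrightarrow> (\<exists>(S, T)\<in>splits U. P \<le>\<^sub>T S \<and> Q \<le>\<^sub>T T)"
proof (induction U arbitrary: P Q)
  case Triv
  show ?case
    by (cases P) (auto simp: tamari_le_Triv_iff)
next
  case (Vee L R)
  show ?case
  proof
    assume "graft_under P Q \<le>\<^sub>T Vee L R"
    then obtain A B C where eq: "graft_under P Q = graft_under A (Vee B C)"
      and L: "graft_under A B \<le>\<^sub>T L" and R: "C \<le>\<^sub>T R"
      by (auto simp: tamari_le_Vee_iff)
    from eq consider
      (cut_A) A' where "A = graft_under P A'" "Q = graft_under A' (Vee B C)"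
    | (cut_C) C' where "P = graft_under A (Vee B C')" "C = graft_under C' Q"
      unfolding graft_under_eq_graft_under_Vee by blast
    then show "\<exists>(S, T)\<in>splits (Vee L R). P \<le>\<^sub>T S \<and> Q \<le>\<^sub>T T"
    proof cases
      case cut_A
      with L have "graft_under P (graft_under A' B) \<le>\<^sub>T L"
        by (simp add: graft_under_assoc)
      then obtain S T where ST: "(S, T) \<in> splits L" "P \<le>\<^sub>T S" "graft_under A' B \<le>\<^sub>T T"
        unfolding Vee.IH by blast
      then have "Q \<le>\<^sub>T Vee T R"
        unfolding tamari_le_Vee_iff using cut_A R by blast
      moreover have "(S, Vee T R) \<in> splits (Vee L R)"
        using ST by (simp add: rev_image_eqI)
      ultimately show ?thesis
        using ST by blast
    next
      case cut_C
      with R obtain S T where ST: "(S, T) \<in> splits R" "C' \<le>\<^sub>T S" "Q \<le>\<^sub>T T"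
        unfolding cut_C Vee.IH by blast
      then have "P \<le>\<^sub>T Vee L S"
        unfolding tamari_le_Vee_iff using cut_C L by blast
      moreover have "(Vee L S, T) \<in> splits (Vee L R)"
        using ST by (simp add: rev_image_eqI)
      ultimately show ?thesis
        using ST by blast
    qed
  next
    assume "\<exists>(S, T)\<in>splits (Vee L R). P \<le>\<^sub>T S \<and> Q \<le>\<^sub>T T"
    then obtain S T where "(S, T) \<in> splits (Vee L R)" and P: "P \<le>\<^sub>T S" and Q: "Q \<le>\<^sub>T T"
      by blast
    then consider (left) T' where "T = Vee T' R" "(S, T') \<in> splits L"
      | (right) S' where "S = Vee L S'" "(S', T) \<in> splits R"
      by auto
    then show "graft_under P Q \<le>\<^sub>T Vee L R"
    proof cases
      case left
      with Q obtain A B C where Q': "Q = graft_under A (Vee B C)"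
        and "graft_under A B \<le>\<^sub>T T'" and R: "C \<le>\<^sub>T R"
        by (auto simp: tamari_le_Vee_iff)
      then have "graft_under P (graft_under A B) \<le>\<^sub>T L"
        unfolding Vee.IH using left P by blast
      then show ?thesis
        unfolding tamari_le_Vee_iff Q' graft_under_assoc[symmetric] using R by blast
    next
      case right
      with P obtain A B C where P': "P = graft_under A (Vee B C)"
        and L: "graft_under A B \<le>\<^sub>T L" and "C \<le>\<^sub>T S'"
        by (auto simp: tamari_le_Vee_iff)
      then have "graft_under C Q \<le>\<^sub>T R"
        unfolding Vee.IH using right Q by blast
      moreover have "graft_under P Q = graft_under A (Vee B (graft_under C Q))"
        by (simp add: P' graft_under_assoc)
      ultimately show ?thesis
        unfolding tamari_le_Vee_iff using L by blast
    qed
  qed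
qed

lemma Vee_graft_over_le: "Vee L (graft_over S T) \<le>\<^sub>T graft_over (Vee L S) T"
proof (induction T)
  case (Vee T1 T2)
  show ?case
    using tamari_le_trans[OF tamari_le_rotate tamari_le_Vee_left[OF Vee.IH(1)]] by simp
qed simp

lemma splits_le_graft_over: "(S, T) \<in> splits U \<Longrightarrow> U \<le>\<^sub>T graft_over S T"
proof (induction U arbitrary: S T)
  case (Vee L R)
  from Vee.prems consider T' where "T = Vee T' R" "(S, T') \<in> splits L"
    | S' where "S = Vee L S'" "(S', T) \<in> splits R"
    by auto
  then show ?case
  proof cases
    case 1
    then show ?thesis
      using Vee.IH(1) by (simp add: tamari_le_Vee_left)
  next
    case 2
    then show ?thesis
      using tamari_le_trans[OF tamari_le_Vee_right Vee_graft_over_le] Vee.IH(2) by blast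
  qed
qed simp

lemma splits_graft_over: "(S, T) \<in> splits (graft_over S T)"
proof (induction T)
  case (Vee T1 T2)
  then show ?case
    by (force simp: image_iff)
qed (simp add: splits_right_Triv)

text \<open>The cut \<open>(S', T')\<close> of \<open>U\<close> with as many vertices on the left as \<open>S\<close> has is the only candidate. The lower
  bound on \<open>U\<close> gives \<open>S \<le> S'\<close> and \<open>T \<le> T'\<close> by adjunction. Cutting is monotone, also by adjunction, and
  \<open>S/T\<close> has the cut \<open>(S, T)\<close>, so the upper bound gives the opposite inequalities.\<close>

lemma star_interval_iff_splits:
  "graft_under S T \<le>\<^sub>T U \<and> U \<le>\<^sub>T graft_over S T \<longleftrightarrow> (S, T) \<in> splits U"
proof
  assume "graft_under S T \<le>\<^sub>T U \<and> U \<le>\<^sub>T graft_over S T"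
  then have lower: "graft_under S T \<le>\<^sub>T U" and upper: "U \<le>\<^sub>T graft_over S T"
    by auto
  from lower obtain S' T' where ST': "(S', T') \<in> splits U" "S \<le>\<^sub>T S'" "T \<le>\<^sub>T T'"
    by (auto simp: graft_under_le_iff)
  then have "graft_under S' T' \<le>\<^sub>T U"
    by (auto simp: graft_under_le_iff intro: bexI[of _ "(S', T')"])
  then have "graft_under S' T' \<le>\<^sub>T graft_over S T"
    using upper tamari_le_trans by blast
  then obtain S'' T'' where ST'': "(S'', T'') \<in> splits (graft_over S T)" "S' \<le>\<^sub>T S''" "T' \<le>\<^sub>T T''"
    by (auto simp: graft_under_le_iff)
  have "nodes S = nodes S''"
    using ST' ST'' by (auto dest!: tamari_le_nodes)
  then have "S = S'' \<and> T = T''"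
    by (intro splits_unique[OF splits_graft_over ST''(1)])
  then show "(S, T) \<in> splits U"
    using ST' ST'' tamari_le_antisym by blast
next
  assume "(S, T) \<in> splits U"
  then show "graft_under S T \<le>\<^sub>T U \<and> U \<le>\<^sub>T graft_over S T"
    by (auto simp: graft_under_le_iff splits_le_graft_over intro: bexI[of _ "(S, T)"])
qed

section \<open>Counting the trees below a given tree\<close>

text \<open>The size of \<open>C\<close> tells where on the right spine the vertex joining \<open>B\<close> and \<open>C\<close> lies; without that
  information there is one decomposition for each spine vertex.\<close>

lemma graft_under_Vee_inject:
  assumes "nodes C = nodes C'" "graft_under A (Vee B C) = graft_under A' (Vee B' C')"
  shows "A = A' \<and> B = B' \<and> C = C'"
  using assms(2)
proof (induction A arbitrary: A')
  case Triv
  with assms(1) show ?case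
    by (cases A') auto
next
  case (Vee L R)
  show ?case
  proof (cases A')
    case Triv
    with Vee.prems have "nodes (graft_under R (Vee B C)) = nodes C'"
      by simp
    with assms(1) show ?thesis
      by simp
  next
    case A': (Vee L' R')
    with Vee.prems have "L = L'" "graft_under R (Vee B C) = graft_under R' (Vee B' C')"
      by simp_all
    with Vee.IH(2)[OF this(2)] A' show ?thesis
      by simp
  qed
qed

definition below :: "pbt \<Rightarrow> nat" where
  "below T = card {S. S \<le>\<^sub>T T}"

lemma below_Triv: "below Triv = 1"
  by (simp add: below_def tamari_le_Triv_iff)

text \<open>By adjunction the pairs form the union, over the cuts \<open>(S, T)\<close> of \<open>U\<close>, of products of the order ideals
  below \<open>S\<close> and below \<open>T\<close>; this union is disjoint since different cuts differ in the size of \<open>S\<close>.\<close>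

lemma card_graft_under_below:
  "card {(P, Q). graft_under P Q \<le>\<^sub>T U} = (\<Sum>(S, T)\<in>splits U. below S * below T)"
proof -
  have eq: "{(P, Q). graft_under P Q \<le>\<^sub>T U} =
      (\<Union>p\<in>splits U. {P. P \<le>\<^sub>T fst p} \<times> {Q. Q \<le>\<^sub>T snd p})"
    by (auto simp: graft_under_le_iff)
  have "({P. P \<le>\<^sub>T fst p} \<times> {Q. Q \<le>\<^sub>T snd p}) \<inter> ({P. P \<le>\<^sub>T fst q} \<times> {Q. Q \<le>\<^sub>T snd q}) = {}"
    if "p \<in> splits U" "q \<in> splits U" "p \<noteq> q" for p q
  proof -
    have "nodes (fst p) \<noteq> nodes (fst q)"
      using splits_unique[of "fst p" "snd p" U "fst q" "snd q"] that by (auto simp: prod_eq_iff)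
    then show ?thesis
      by (auto dest!: tamari_le_nodes)
  qed
  then have "card {(P, Q). graft_under P Q \<le>\<^sub>T U} =
      (\<Sum>p\<in>splits U. card ({P. P \<le>\<^sub>T fst p} \<times> {Q. Q \<le>\<^sub>T snd p}))"
    unfolding eq by (intro card_UN_disjoint ballI impI) (simp_all add: finite_tamari_below)
  then show ?thesis
    by (simp only: card_cartesian_product below_def case_prod_unfold)
qed

lemma below_Vee: "below (Vee L R) = (\<Sum>(S, T)\<in>splits L. below S * below T) * below R"
proof -
  let ?g = "\<lambda>p. graft_under (fst (fst p)) (Vee (snd (fst p)) (snd p))"
  let ?X = "{(A, B). graft_under A B \<le>\<^sub>T L} \<times> {C. C \<le>\<^sub>T R}"
  have "bij_betw ?g ?X {S. S \<le>\<^sub>T Vee L R}"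
  proof (rule bij_betw_imageI)
    show "inj_on ?g ?X"
    proof (rule inj_onI)
      fix x y assume xy: "x \<in> ?X" "y \<in> ?X" "?g x = ?g y"
      then have "snd x \<le>\<^sub>T R" "snd y \<le>\<^sub>T R"
        by auto
      then have "nodes (snd x) = nodes (snd y)"
        by (simp add: tamari_le_nodes)
      from graft_under_Vee_inject[OF this xy(3)] show "x = y"
        by (simp add: prod_eq_iff)
    qed
    show "?g ` ?X = {S. S \<le>\<^sub>T Vee L R}"
    proof (intro equalityI subsetI)
      fix S assume "S \<in> {S. S \<le>\<^sub>T Vee L R}"
      then obtain A B C where "S = graft_under A (Vee B C)" "graft_under A B \<le>\<^sub>T L" "C \<le>\<^sub>T R"
        unfolding mem_Collect_eq tamari_le_Vee_iff by blast
      then show "S \<in> ?g ` ?X"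
        by (intro image_eqI[of _ _ "((A, B), C)"]) simp_all
    next
      fix S assume "S \<in> ?g ` ?X"
      then show "S \<in> {S. S \<le>\<^sub>T Vee L R}"
        unfolding mem_Collect_eq tamari_le_Vee_iff by (elim imageE) (auto, blast)
    qed
  qed
  then have "below (Vee L R) = card ?X"
    by (simp add: below_def bij_betw_same_card)
  then show ?thesis
    by (simp add: card_cartesian_product card_graft_under_below below_def)
qed

section \<open>Dendriform products of series\<close>

lemma star_tree_coeff: "star_tree S T U = (if (S, T) \<in> splits U then 1 else 0)"
  by (simp add: star_tree_def formal_sum_of_tree star_interval_iff_splits)

text \<open>With this formula the Tamari order disappears from the algebra: the products of series become finite
  sums over cuts, and identities between them are proved by recursion on the tree.\<close>

lemma star_coeff: "star F G U = (\<Sum>(S, T)\<in>splits U. F S * G T)"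
proof -
  have "star F G U = (\<Sum>a\<in>{a. (case a of (S, T) \<Rightarrow> smult_series (F S * G T) (star_tree S T)) U \<noteq> 0}.
      (case a of (S, T) \<Rightarrow> smult_series (F S * G T) (star_tree S T)) U)"
    by (simp add: star_def bilinear_ext_def formal_sum_def)
  also have "\<dots> = (\<Sum>a\<in>splits U. (case a of (S, T) \<Rightarrow> smult_series (F S * G T) (star_tree S T)) U)"
    by (rule sum.mono_neutral_left)
      (auto simp: smult_series_def star_tree_coeff split: if_splits)
  also have "\<dots> = (\<Sum>(S, T)\<in>splits U. F S * G T)"
    by (rule sum.cong) (auto simp: smult_series_def star_tree_coeff)
  finally show ?thesis .
qed

lemma star_Triv [simp]: "star F G Triv = F Triv * G Triv"
  by (simp add: star_coeff)

lemma star_Vee: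
  "star F G (Vee L R) = star F (\<lambda>T. G (Vee T R)) L + star (\<lambda>S. F (Vee L S)) G R"
  unfolding star_coeff sum_splits_Vee ..

lemma vee_Triv [simp]: "vee F G Triv = 0"
proof -
  have False if "vee F G Triv \<noteq> 0"
    using bilinear_ext_nonzeroD[OF that[unfolded vee_def]] by (auto dest: of_tree_nonzeroD)
  then show ?thesis
    by blast
qed

lemma vee_Vee [simp]: "vee F G (Vee L R) = F L * G R"
proof -
  have "vee F G (Vee L R) =
      (\<Sum>a\<in>{a. (case a of (S, T) \<Rightarrow> smult_series (F S * G T) (of_tree (Vee S T))) (Vee L R) \<noteq> 0}.
      (case a of (S, T) \<Rightarrow> smult_series (F S * G T) (of_tree (Vee S T))) (Vee L R))"
    by (simp add: vee_def bilinear_ext_def formal_sum_def)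
  also have "\<dots> =
      (\<Sum>a\<in>{(L, R)}. (case a of (S, T) \<Rightarrow> smult_series (F S * G T) (of_tree (Vee S T))) (Vee L R))"
    by (rule sum.mono_neutral_left)
      (auto simp: smult_series_def of_tree_def split: if_splits)
  finally show ?thesis
    by (simp add: smult_series_def of_tree_def)
qed

lemma star_of_tree: "star (of_tree S) (of_tree T) = star_tree S T"
proof
  fix U
  have "star (of_tree S) (of_tree T) U = (\<Sum>a\<in>splits U. if a = (S, T) then 1 else 0 :: 'a)"
    unfolding star_coeff by (rule sum.cong) (auto simp: of_tree_def split: if_splits)
  then show "star (of_tree S) (of_tree T) U = (star_tree S T U :: 'a)"
    by (simp add: star_tree_coeff)
qed

lemma dend_prec_Triv [simp]: "dend_prec F G Triv = 0"
proof -
  have *: "prec_tree S T Triv = (0 :: 'a)" for S T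
    by (cases S) simp_all
  have False if "dend_prec F G Triv \<noteq> 0"
    using bilinear_ext_nonzeroD[OF that[unfolded dend_prec_def]] by (simp add: *)
  then show ?thesis
    by blast
qed

lemma dend_succ_Triv [simp]: "dend_succ F G Triv = 0"
proof -
  have *: "succ_tree S T Triv = (0 :: 'a)" for S T
    by (cases T) simp_all
  have False if "dend_succ F G Triv \<noteq> 0"
    using bilinear_ext_nonzeroD[OF that[unfolded dend_succ_def]] by (simp add: *)
  then show ?thesis
    by blast
qed

lemma prec_tree_coeff:
  "prec_tree S T (Vee L R) = (if \<exists>S2. S = Vee L S2 \<and> (S2, T) \<in> splits R then 1 else 0)"
  by (cases S) (simp_all add: star_of_tree star_tree_coeff, simp add: of_tree_def)

lemma succ_tree_coeff:
  "succ_tree S T (Vee L R) = (if \<exists>T1. T = Vee T1 R \<and> (S, T1) \<in> splits L then 1 else 0)"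
  by (cases T) (simp_all add: star_of_tree star_tree_coeff, simp add: of_tree_def)

text \<open>The two halves of the product correspond to the two kinds of cuts of \<open>L \<or> R\<close>: those through \<open>R\<close>,
  where the root belongs to the left factor, and those through \<open>L\<close> (for the other product). These
  formulas also give sensible values when the factor that does not contribute the root has a
  constant term, so that the trivial tree can act as a unit on that side.\<close>

lemma dend_prec_Vee: "dend_prec F G (Vee L R) = star (\<lambda>S. F (Vee L S)) G R"
proof -
  let ?f = "\<lambda>a. (case a of (S, T) \<Rightarrow> smult_series (F S * G T) (prec_tree S T)) (Vee L R)"
  let ?g = "\<lambda>(S, T). (Vee L S, T)"
  have "dend_prec F G (Vee L R) = (\<Sum>a\<in>{a. ?f a \<noteq> 0}. ?f a)"
    by (simp add: dend_prec_def bilinear_ext_def formal_sum_def)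
  also have "\<dots> = (\<Sum>a\<in>?g ` splits R. ?f a)"
    by (rule sum.mono_neutral_left)
      (auto simp: smult_series_def prec_tree_coeff simp del: prec_tree.simps split: if_splits)
  also have "\<dots> = (\<Sum>a\<in>splits R. ?f (?g a))"
    by (subst sum.reindex) (auto simp: inj_on_def)
  also have "\<dots> = star (\<lambda>S. F (Vee L S)) G R"
    unfolding star_coeff by (rule sum.cong) (auto simp: smult_series_def prec_tree_coeff simp del: prec_tree.simps)
  finally show ?thesis .
qed

lemma dend_succ_Vee: "dend_succ F G (Vee L R) = star F (\<lambda>T. G (Vee T R)) L"
proof -
  let ?f = "\<lambda>a. (case a of (S, T) \<Rightarrow> smult_series (F S * G T) (succ_tree S T)) (Vee L R)"
  let ?g = "\<lambda>(S, T). (S, Vee T R)"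
  have "dend_succ F G (Vee L R) = (\<Sum>a\<in>{a. ?f a \<noteq> 0}. ?f a)"
    by (simp add: dend_succ_def bilinear_ext_def formal_sum_def)
  also have "\<dots> = (\<Sum>a\<in>?g ` splits L. ?f a)"
    by (rule sum.mono_neutral_left)
      (auto simp: smult_series_def succ_tree_coeff simp del: succ_tree.simps split: if_splits)
  also have "\<dots> = (\<Sum>a\<in>splits L. ?f (?g a))"
    by (subst sum.reindex) (auto simp: inj_on_def)
  also have "\<dots> = star F (\<lambda>T. G (Vee T R)) L"
    unfolding star_coeff by (rule sum.cong) (auto simp: smult_series_def succ_tree_coeff simp del: succ_tree.simps)
  finally show ?thesis .
qed

lemma star_unit_right [simp]: "star F (of_tree Triv) = F"
proof
  fix U
  have "star F (of_tree Triv) U = (\<Sum>a\<in>splits U. if a = (U, Triv) then F U else 0)"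
    unfolding star_coeff by (rule sum.cong) (auto simp: of_tree_def splits_right_Triv split: if_splits)
  then show "star F (of_tree Triv) U = F U"
    by (simp add: splits_right_Triv)
qed

lemma star_unit_left [simp]: "star (of_tree Triv) F = F"
proof
  fix U
  have "star (of_tree Triv) F U = (\<Sum>a\<in>splits U. if a = (Triv, U) then F U else 0)"
    unfolding star_coeff by (rule sum.cong) (auto simp: of_tree_def splits_left_Triv split: if_splits)
  then show "star (of_tree Triv) F U = F U"
    by (simp add: splits_left_Triv)
qed

lemma star_add_left: "star (\<lambda>T. F T + G T) H U = star F H U + star G H U"
  by (simp add: star_coeff case_prod_unfold distrib_right sum.distrib)

lemma star_add_right: "star F (\<lambda>T. G T + H T) U = star F G U + star F H U"
  by (simp add: star_coeff case_prod_unfold distrib_left sum.distrib)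

lemma star_scale_left: "star (\<lambda>T. c * F T) H U = c * star F H U"
  by (simp add: star_coeff case_prod_unfold sum_distrib_left mult.assoc)

lemma star_scale_right: "star F (\<lambda>T. c * G T) U = c * star F G U"
  by (simp add: star_coeff case_prod_unfold sum_distrib_left mult.left_commute)

lemma star_scale_right': "star F (\<lambda>T. G T * c) U = star F G U * c"
  using star_scale_right[of F c G U] by (simp add: mult.commute)

lemma star_sum_left: "star (\<lambda>T. \<Sum>i\<in>I. F i T) H U = (\<Sum>i\<in>I. star (F i) H U)"
  unfolding star_coeff sum_distrib_right case_prod_unfold by (rule sum.swap)

lemma star_sum_right: "star F (\<lambda>T. \<Sum>i\<in>I. G i T) U = (\<Sum>i\<in>I. star F (G i) U)"
  unfolding star_coeff sum_distrib_left case_prod_unfold by (rule sum.swap)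

text \<open>Two cuts of \<open>L \<or> R\<close> lie both in \<open>L\<close>, both in \<open>R\<close>, or one on each side of the root. The first two cases
  are handled by induction, and the mixed case contributes the same sum \<open>mid\<close> to both bracketings.\<close>

lemma star_assoc: "star (star F G) H = star F (star G H)"
proof
  fix U
  show "star (star F G) H U = star F (star G H) U"
  proof (induction U arbitrary: F G H)
    case (Vee L R)
    let ?mid = "\<Sum>p\<in>splits L. F (fst p) * star (\<lambda>S. G (Vee (snd p) S)) H R"
    have "star (\<lambda>S. star F G (Vee L S)) H R =
        star (\<lambda>S. star F (\<lambda>T. G (Vee T S)) L) H R + star (star (\<lambda>S. F (Vee L S)) G) H R"
      unfolding star_Vee star_add_left ..
    also have "star (\<lambda>S. star F (\<lambda>T. G (Vee T S)) L) H R = ?mid"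
      unfolding star_coeff[of F] case_prod_unfold star_sum_left star_scale_left ..
    finally have 1: "star (\<lambda>S. star F G (Vee L S)) H R =
        ?mid + star (star (\<lambda>S. F (Vee L S)) G) H R" .
    have "star F (\<lambda>T. star G H (Vee T R)) L =
        star F (star G (\<lambda>T. H (Vee T R))) L + star F (\<lambda>T. star (\<lambda>S. G (Vee T S)) H R) L"
      unfolding star_Vee star_add_right ..
    also have "star F (\<lambda>T. star (\<lambda>S. G (Vee T S)) H R) L = ?mid"
      unfolding star_coeff[of F] case_prod_unfold ..
    finally have 2: "star F (\<lambda>T. star G H (Vee T R)) L =
        star F (star G (\<lambda>T. H (Vee T R))) L + ?mid" .
    show ?case
      unfolding star_Vee[of "star F G" H] star_Vee[of F "star G H"] 1 2 Vee.IH by simp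
  qed (simp add: mult.assoc)
qed

lemma series_eqI:
  assumes "F Triv = G Triv" "\<And>L R. F (Vee L R) = G (Vee L R)"
  shows "F = G"
proof
  fix U show "F U = G U"
    using assms by (cases U) auto
qed

lemma dend_succ_succ: "dend_succ F (dend_succ G H) = dend_succ (star F G) H"
  by (rule series_eqI) (simp_all add: dend_succ_Vee star_assoc)

lemma dend_prec_prec: "dend_prec (dend_prec F G) H = dend_prec F (star G H)"
  by (rule series_eqI) (simp_all add: dend_prec_Vee star_assoc)

lemma dend_succ_prec_coeff:
  "dend_succ F (dend_prec G H) (Vee L R) =
    (\<Sum>p\<in>splits L. \<Sum>q\<in>splits R. F (fst p) * G (Vee (snd p) (fst q)) * H (snd q))"
  unfolding dend_succ_Vee dend_prec_Vee star_coeff case_prod_unfold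
  by (simp add: sum_distrib_left mult.assoc)

lemma dend_prec_succ: "dend_prec (dend_succ F G) H = dend_succ F (dend_prec G H)"
proof (rule series_eqI)
  fix L R
  have "dend_prec (dend_succ F G) H (Vee L R) =
      (\<Sum>q\<in>splits R. \<Sum>p\<in>splits L. F (fst p) * G (Vee (snd p) (fst q)) * H (snd q))"
    unfolding dend_succ_Vee dend_prec_Vee star_coeff case_prod_unfold
    by (simp add: sum_distrib_right)
  then show "dend_prec (dend_succ F G) H (Vee L R) = dend_succ F (dend_prec G H) (Vee L R)"
    unfolding dend_succ_prec_coeff by (subst sum.swap) simp
qed simp

lemma dend_prec_unit [simp]: "G Triv = 0 \<Longrightarrow> dend_prec G (of_tree Triv) = G"
  by (rule series_eqI) (simp_all add: dend_prec_Vee)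

lemma dend_succ_unit [simp]: "G Triv = 0 \<Longrightarrow> dend_succ (of_tree Triv) G = G"
  by (rule series_eqI) (simp_all add: dend_succ_Vee)

lemma star_eq_prec_succ: "star F G (Vee L R) = dend_prec F G (Vee L R) + dend_succ F G (Vee L R)"
  by (simp add: star_Vee dend_prec_Vee dend_succ_Vee)

section \<open>Substitution of series\<close>

text \<open>The operation of a tree evaluated with all arguments equal to \<open>H\<close>. Sending the trivial tree to the
  unit removes the case distinctions on trivial subtrees, since the unit acts trivially on \<open>H\<close>.\<close>

fun subst_tree :: "'k::field series \<Rightarrow> pbt \<Rightarrow> 'k series" where
  "subst_tree H Triv = of_tree Triv"
| "subst_tree H (Vee L R) = dend_succ (subst_tree H L) (dend_prec H (subst_tree H R))"

lemma dend_act_replicate: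
  assumes "H Triv = 0" "T \<noteq> Triv"
  shows "dend_act T (replicate (nodes T) H) = subst_tree H T"
  using assms(2)
proof (induction T)
  case (Vee L R)
  have "(H # replicate (nodes L + nodes R) H) ! nodes L = H"
    using nth_replicate[of "nodes L" "Suc (nodes L + nodes R)" H] by simp
  moreover have "take (nodes L) (H # replicate (nodes L + nodes R) H) = replicate (nodes L) H"
    using take_replicate[of "nodes L" "Suc (nodes L + nodes R)" H] by simp
  ultimately show ?case
    using Vee.IH assms(1) by (cases "L = Triv"; cases "R = Triv") (simp_all add: Let_def)
qed simp

lemma subst_tree_nonzeroD:
  assumes "H Triv = 0" "subst_tree H T U \<noteq> 0"
  shows "nodes T \<le> nodes U"
proof (cases "T = Triv")
  case False
  then show ?thesis
    using dend_act_nonzeroD[of "replicate (nodes T) H" T U] assms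
    by (simp add: dend_act_replicate)
qed simp

lemma subst_tree_eq_0: "H Triv = 0 \<Longrightarrow> \<not> nodes T \<le> nodes U \<Longrightarrow> subst_tree H T U = 0"
  using subst_tree_nonzeroD by blast

text \<open>The finite range of summation suffices when \<open>H\<close> has no constant term, for then \<open>subst_tree H T\<close>
  starts in degree \<open>nodes T\<close>. The trivial tree is a summand, so series with a constant term, such as
  \<open>1 + \<Phi>\<close>, can be substituted into as well.\<close>

definition series_subst :: "'k::field series \<Rightarrow> 'k series \<Rightarrow> 'k series" where
  "series_subst H F = (\<lambda>U. \<Sum>T | nodes T \<le> nodes U. F T * subst_tree H T U)"

lemma series_subst_bound:
  assumes "H Triv = 0" "nodes U \<le> n"
  shows "series_subst H F U = (\<Sum>T | nodes T \<le> n. F T * subst_tree H T U)"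
  unfolding series_subst_def
  by (rule sum.mono_neutral_left) (use assms in \<open>auto simp: finite_nodes_le subst_tree_eq_0\<close>)

lemma dend_comp_eq_series_subst:
  assumes "F Triv = 0" "H Triv = 0"
  shows "dend_comp F H = series_subst H F"
proof
  fix U
  have mem: "T \<in> (\<Union>n\<in>{1..}. Y_trees n) \<longleftrightarrow> T \<noteq> Triv" for T
    by (cases T) (auto simp: Y_trees_def)
  let ?f = "\<lambda>T. smult_series (F T) (dend_act T (replicate (nodes T) H)) U"
  have f: "?f T = F T * subst_tree H T U" if "T \<noteq> Triv" for T
    using that assms by (simp add: smult_series_def dend_act_replicate)
  have "dend_comp F H U = (\<Sum>T | T \<noteq> Triv \<and> ?f T \<noteq> 0. ?f T)"
    unfolding dend_comp_def formal_sum_def mem ..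
  also have "\<dots> = (\<Sum>T | T \<noteq> Triv \<and> ?f T \<noteq> 0. F T * subst_tree H T U)"
    by (rule sum.cong) (simp_all add: f)
  also have "\<dots> = series_subst H F U"
    unfolding series_subst_def
  proof (rule sum.mono_neutral_left)
    show "{T. T \<noteq> Triv \<and> ?f T \<noteq> 0} \<subseteq> {T. nodes T \<le> nodes U}"
      using subst_tree_nonzeroD[of H, OF assms(2)] by (auto simp: f)
    show "\<forall>T\<in>{T. nodes T \<le> nodes U} - {T. T \<noteq> Triv \<and> ?f T \<noteq> 0}. F T * subst_tree H T U = 0"
    proof
      fix T assume T: "T \<in> {T. nodes T \<le> nodes U} - {T. T \<noteq> Triv \<and> ?f T \<noteq> 0}"
      show "F T * subst_tree H T U = 0"
      proof (cases "T = Triv")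
        case False
        with T show ?thesis
          unfolding f[OF False, symmetric] by blast
      qed (simp add: assms(1))
    qed
  qed (rule finite_nodes_le)
  finally show "dend_comp F H U = series_subst H F U" .
qed

lemma dend_prec_sum_right:
  "dend_prec F (\<lambda>T. \<Sum>i\<in>I. G i T) = (\<lambda>U. \<Sum>i\<in>I. dend_prec F (G i) U)"
  by (rule series_eqI) (simp_all add: dend_prec_Vee star_sum_right)

lemma dend_succ_sum_right:
  "dend_succ F (\<lambda>T. \<Sum>i\<in>I. G i T) = (\<lambda>U. \<Sum>i\<in>I. dend_succ F (G i) U)"
  by (rule series_eqI) (simp_all add: dend_succ_Vee star_sum_right)

lemma dend_succ_sum_left:
  "dend_succ (\<lambda>T. \<Sum>i\<in>I. F i T) G = (\<lambda>U. \<Sum>i\<in>I. dend_succ (F i) G U)"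
  by (rule series_eqI) (simp_all add: dend_succ_Vee star_sum_left)

lemma finite_splits_fiber: "finite {V. (S, T) \<in> splits V}"
  by (rule finite_subset[OF _ finite_nodes_le[of "nodes S + nodes T"]]) (auto dest: splits_nodes)

text \<open>The trees occurring in \<open>S * T\<close>, sorted by whether their root comes from \<open>S\<close> or from \<open>T\<close>; this is the
  decomposition of the product into its two dendriform halves.\<close>

lemma splits_fiber_Vee:
  "{V. (Vee S1 S2, Vee T1 T2) \<in> splits V} =
    Vee S1 ` {V. (S2, Vee T1 T2) \<in> splits V} \<union> (\<lambda>V. Vee V T2) ` {V. (Vee S1 S2, T1) \<in> splits V}"
  (is "?A = ?B")
proof (intro equalityI subsetI)
  fix V assume "V \<in> ?A"
  then show "V \<in> ?B"
    by (cases V) auto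
next
  fix V assume "V \<in> ?B"
  then show "V \<in> ?A"
    by (auto simp: rev_image_eqI)
qed

text \<open>Evaluation at \<open>H\<close> is multiplicative on trees. Only the dendriform axioms enter: with \<open>s\<^sub>i\<close> and \<open>t\<^sub>i\<close> for
  the values at \<open>H\<close> of the subtrees of \<open>S\<close> and \<open>T\<close>, and \<open>s\<close>, \<open>t\<close> for those of \<open>S\<close> and \<open>T\<close>, the part of
  the product with root in \<open>S\<close> is \<open>(s\<^sub>1 \<succ> H \<prec> s\<^sub>2) \<prec> t = s\<^sub>1 \<succ> H \<prec> (s\<^sub>2 * t)\<close>, the other part is
  \<open>s \<succ> (t\<^sub>1 \<succ> H \<prec> t\<^sub>2) = (s * t\<^sub>1) \<succ> H \<prec> t\<^sub>2\<close>, and induction applies to the smaller products.\<close>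

lemma star_subst_tree:
  assumes H: "H Triv = 0"
  shows "star (subst_tree H S) (subst_tree H T) =
    (\<lambda>W. \<Sum>V | (S, T) \<in> splits V. subst_tree H V W)"
proof (induction "nodes S + nodes T" arbitrary: S T rule: less_induct)
  case less
  show ?case
  proof (cases S)
    case Triv
    then show ?thesis
      by (simp add: splits_left_Triv)
  next
    case S: (Vee S1 S2)
    show ?thesis
    proof (cases T)
      case Triv
      then show ?thesis
        by (simp add: splits_right_Triv)
    next
      case T: (Vee T1 T2)
      let ?s = "subst_tree H"
      let ?P = "{V. (S2, T) \<in> splits V}" and ?Q = "{V. (S, T1) \<in> splits V}"
      have IH: "star (?s S2) (?s T) = (\<lambda>W. \<Sum>V\<in>?P. ?s V W)"
               "star (?s S) (?s T1) = (\<lambda>W. \<Sum>V\<in>?Q. ?s V W)"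
        by (intro less; simp add: S T)+
      have disj: "Vee S1 ` ?P \<inter> (\<lambda>V. Vee V T2) ` ?Q = {}"
        by (auto simp: S dest: splits_nodes)
      have prec: "dend_prec (?s S) (?s T) = (\<lambda>W. \<Sum>V\<in>?P. ?s (Vee S1 V) W)"
        unfolding S subst_tree.simps dend_prec_succ dend_prec_prec
        by (simp only: IH[unfolded S] dend_prec_sum_right dend_succ_sum_right)
      have succ: "dend_succ (?s S) (?s T) = (\<lambda>W. \<Sum>V\<in>?Q. ?s (Vee V T2) W)"
        unfolding T subst_tree.simps dend_succ_succ
        by (simp only: IH dend_succ_sum_left)
      have "(\<Sum>V | (S, T) \<in> splits V. ?s V W) =
          (\<Sum>V\<in>?P. ?s (Vee S1 V) W) + (\<Sum>V\<in>?Q. ?s (Vee V T2) W)" for W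
      proof -
        have "{V. (S, T) \<in> splits V} = Vee S1 ` ?P \<union> (\<lambda>V. Vee V T2) ` ?Q"
          unfolding S T by (rule splits_fiber_Vee)
        then have "(\<Sum>V | (S, T) \<in> splits V. ?s V W) =
            (\<Sum>V\<in>Vee S1 ` ?P. ?s V W) + (\<Sum>V\<in>(\<lambda>V. Vee V T2) ` ?Q. ?s V W)"
          by (simp only:) (intro sum.union_disjoint finite_imageI finite_splits_fiber disj)
        also have "(\<Sum>V\<in>Vee S1 ` ?P. ?s V W) = (\<Sum>V\<in>?P. ?s (Vee S1 V) W)"
          by (rule sum.reindex_cong[OF _ refl refl]) (auto intro: inj_onI)
        also have "(\<Sum>V\<in>(\<lambda>V. Vee V T2) ` ?Q. ?s V W) = (\<Sum>V\<in>?Q. ?s (Vee V T2) W)"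
          by (rule sum.reindex_cong[OF _ refl refl]) (auto intro: inj_onI)
        finally show ?thesis .
      qed
      then have sum: "(\<lambda>W. \<Sum>V | (S, T) \<in> splits V. ?s V W) =
          (\<lambda>W. dend_prec (?s S) (?s T) W + dend_succ (?s S) (?s T) W)"
        unfolding prec succ by (rule ext)
      show ?thesis
        unfolding sum by (rule series_eqI) (simp add: S T, rule star_eq_prec_succ)
    qed
  qed
qed

lemma star_cong:
  assumes "\<And>T. nodes T \<le> nodes U \<Longrightarrow> F T = F' T" "\<And>T. nodes T \<le> nodes U \<Longrightarrow> G T = G' T"
  shows "star F G U = star F' G' U"
  unfolding star_coeff
proof (rule sum.cong[OF refl])
  fix p assume "p \<in> splits U"
  then have "nodes (fst p) + nodes (snd p) = nodes U"
    by (cases p) (simp add: splits_nodes)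
  then show "(case p of (S, T) \<Rightarrow> F S * G T) = (case p of (S, T) \<Rightarrow> F' S * G' T)"
    using assms by (simp add: case_prod_unfold)
qed

text \<open>The extension of multiplicativity from trees to series. All sums are restricted to trees with at
  most as many vertices as \<open>U\<close>, which are the only ones that contribute to the coefficient at \<open>U\<close>; they
  are then finite and can be interchanged.\<close>

lemma series_subst_star:
  assumes H: "H Triv = 0"
  shows "series_subst H (star F G) = star (series_subst H F) (series_subst H G)"
proof
  fix U
  let ?N = "{T. nodes T \<le> nodes U}" and ?s = "subst_tree H"
  have fiber: "(\<Sum>V\<in>?N. if (S, T) \<in> splits V then ?s V U else 0) = star (?s S) (?s T) U" for S T
  proof -
    have "(\<Sum>V\<in>?N. if (S, T) \<in> splits V then ?s V U else 0) =
        (\<Sum>V\<in>?N \<inter> {V. (S, T) \<in> splits V}. ?s V U)"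
      by (simp add: sum.inter_restrict finite_nodes_le)
    also have "\<dots> = (\<Sum>V | (S, T) \<in> splits V. ?s V U)"
      by (rule sum.mono_neutral_left)
        (use subst_tree_nonzeroD[of H, OF H] in \<open>auto simp: finite_splits_fiber\<close>)
    finally show ?thesis
      by (simp add: star_subst_tree H)
  qed
  have "series_subst H (star F G) U = (\<Sum>V\<in>?N. star F G V * ?s V U)"
    by (simp add: series_subst_def)
  also have "\<dots> = (\<Sum>V\<in>?N. \<Sum>S\<in>?N. \<Sum>T\<in>?N. F S * (G T * (if (S, T) \<in> splits V then ?s V U else 0)))"
  proof (rule sum.cong[OF refl])
    fix V assume V: "V \<in> ?N"
    have "splits V \<subseteq> ?N \<times> ?N"
      using V by (auto dest: splits_nodes)
    then have "star F G V * ?s V U = (\<Sum>p\<in>?N \<times> ?N. if p \<in> splits V then F (fst p) * G (snd p) * ?s V U else 0)"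
      by (simp add: star_coeff case_prod_unfold sum_distrib_right finite_nodes_le
          sum.inter_restrict[symmetric] inf.absorb2)
    also have "\<dots> = (\<Sum>S\<in>?N. \<Sum>T\<in>?N. F S * (G T * (if (S, T) \<in> splits V then ?s V U else 0)))"
      unfolding sum.cartesian_product by (rule sum.cong) auto
    finally show "star F G V * ?s V U =
        (\<Sum>S\<in>?N. \<Sum>T\<in>?N. F S * (G T * (if (S, T) \<in> splits V then ?s V U else 0)))" .
  qed
  also have "\<dots> = (\<Sum>S\<in>?N. \<Sum>V\<in>?N. \<Sum>T\<in>?N. F S * (G T * (if (S, T) \<in> splits V then ?s V U else 0)))"
    by (rule sum.swap)
  also have "\<dots> = (\<Sum>S\<in>?N. \<Sum>T\<in>?N. \<Sum>V\<in>?N. F S * (G T * (if (S, T) \<in> splits V then ?s V U else 0)))"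
    by (intro sum.cong refl sum.swap)
  also have "\<dots> = (\<Sum>S\<in>?N. \<Sum>T\<in>?N. F S * (G T * star (?s S) (?s T) U))"
    by (simp only: sum_distrib_left[symmetric] fiber)
  also have "\<dots> = star (\<lambda>W. \<Sum>S\<in>?N. F S * ?s S W) (\<lambda>W. \<Sum>T\<in>?N. G T * ?s T W) U"
    by (simp only: star_sum_left star_sum_right star_scale_left star_scale_right sum_distrib_left)
  also have "\<dots> = star (series_subst H F) (series_subst H G) U"
    by (rule star_cong) (simp_all add: series_subst_bound H)
  finally show "series_subst H (star F G) U = star (series_subst H F) (series_subst H G) U" .
qed

lemma series_subst_vee:
  assumes H: "H Triv = 0"
  shows "series_subst H (vee F G) = dend_succ (series_subst H F) (dend_prec H (series_subst H G))"
proof (rule series_eqI)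
  have "T = Triv" if "nodes T \<le> 0" for T
    using that by (cases T) auto
  then have "{T. nodes T \<le> 0} = {Triv}"
    by auto
  then show "series_subst H (vee F G) Triv =
      dend_succ (series_subst H F) (dend_prec H (series_subst H G)) Triv"
    by (simp add: series_subst_def)
next
  fix A B
  let ?U = "Vee A B"
  let ?N = "{T. nodes T \<le> nodes ?U}" and ?s = "subst_tree H"
  let ?f = "\<lambda>V. vee F G V * ?s V ?U"
  let ?I = "case_prod Vee ` (?N \<times> ?N)"
  have "series_subst H (vee F G) ?U = sum ?f ?N"
    by (simp add: series_subst_def)
  also have "\<dots> = sum ?f (insert Triv ?I)"
  proof (rule sum.mono_neutral_left)
    show "?N \<subseteq> insert Triv ?I"
    proof
      fix V assume "V \<in> ?N"
      then show "V \<in> insert Triv ?I"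
        by (cases V) (auto simp: image_iff)
    qed
  qed (auto simp: finite_nodes_le subst_tree_eq_0 H simp del: nodes.simps subst_tree.simps)
  also have "\<dots> = sum ?f ?I"
    by (subst sum.insert) (auto simp: finite_nodes_le simp del: nodes.simps)
  also have "\<dots> = (\<Sum>p\<in>?N \<times> ?N. ?f (case_prod Vee p))"
    by (rule sum.reindex_cong[OF _ refl refl]) (auto intro: inj_onI)
  also have "\<dots> = (\<Sum>S\<in>?N. \<Sum>T\<in>?N. F S * (G T * dend_succ (?s S) (dend_prec H (?s T)) ?U))"
    unfolding sum.cartesian_product by (rule sum.cong) (auto simp: mult.assoc)
  also have "\<dots> = dend_succ (\<lambda>W. \<Sum>S\<in>?N. F S * ?s S W) (dend_prec H (\<lambda>W. \<Sum>T\<in>?N. G T * ?s T W)) ?U"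
    by (simp only: dend_succ_Vee dend_prec_Vee star_sum_left star_sum_right star_scale_left
        star_scale_right sum_distrib_left)
  also have "\<dots> = dend_succ (series_subst H F) (dend_prec H (series_subst H G)) ?U"
    unfolding dend_succ_Vee dend_prec_Vee
    by (intro star_cong) (simp_all add: series_subst_bound[of H _ "nodes ?U"] H)
  finally show "series_subst H (vee F G) ?U =
      dend_succ (series_subst H F) (dend_prec H (series_subst H G)) ?U" .
qed

lemma series_subst_add: "series_subst H (\<lambda>T. F T + G T) = (\<lambda>U. series_subst H F U + series_subst H G U)"
  by (simp add: series_subst_def distrib_right sum.distrib)

lemma series_subst_of_tree:
  assumes "H Triv = 0"
  shows "series_subst H (of_tree T) = subst_tree H T"
proof
  fix U
  have "series_subst H (of_tree T) U = (\<Sum>V | nodes V \<le> nodes U. if V = T then subst_tree H T U else 0)"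
    unfolding series_subst_def by (rule sum.cong) (auto simp: of_tree_def)
  then show "series_subst H (of_tree T) U = subst_tree H T U"
    using assms by (simp add: finite_nodes_le subst_tree_eq_0)
qed

lemma series_subst_unit: "H Triv = 0 \<Longrightarrow> series_subst H (of_tree Triv) = of_tree Triv"
  by (simp add: series_subst_of_tree)

lemma series_subst_Y: "H Triv = 0 \<Longrightarrow> series_subst H (of_tree Y_tree) = H"
  by (simp add: series_subst_of_tree)

section \<open>Functional equations and inversion\<close>

definition below_series :: "'k::field series" where
  "below_series T = of_nat (below T)"

definition unit_plus_Y :: "'k::field series" where
  "unit_plus_Y T = of_tree Triv T + of_tree Y_tree T"

definition sign_series :: "'k::field series" where
  "sign_series T = (- 1) ^ nodes T"

lemma Phi_Triv: "Phi Triv = 0"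
proof -
  have False if "Phi Triv \<noteq> (0 :: 'k::field)"
    using formal_sum_nonzeroD[OF that[unfolded Phi_def]]
    by (auto simp: intervals_def Y_trees_def dest: of_tree_nonzeroD)
  then show ?thesis
    by blast
qed

lemma below_series_eq_unit_plus_Phi: "below_series = (\<lambda>U. of_tree Triv U + Phi U)"
proof (rule series_eqI)
  show "below_series Triv = of_tree Triv Triv + Phi Triv"
    by (simp add: below_series_def below_Triv Phi_Triv of_tree_def)
next
  fix L R
  let ?U = "Vee L R"
  let ?X = "{a \<in> \<Union>n\<in>{1..}. intervals n. (case a of (S, T) \<Rightarrow> of_tree T) ?U \<noteq> (0 :: 'a)}"
  have "?X = (\<lambda>S. (S, ?U)) ` {S. S \<le>\<^sub>T ?U}"
  proof (intro equalityI subsetI)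
    fix p assume "p \<in> ?X"
    then show "p \<in> (\<lambda>S. (S, ?U)) ` {S. S \<le>\<^sub>T ?U}"
      by (auto simp: intervals_def dest: of_tree_nonzeroD)
  next
    fix p assume "p \<in> (\<lambda>S. (S, ?U)) ` {S. S \<le>\<^sub>T ?U}"
    then obtain S where p: "p = (S, ?U)" and S: "S \<le>\<^sub>T ?U"
      by auto
    then have "p \<in> intervals (nodes ?U)"
      using tamari_le_nodes[OF S] by (simp add: intervals_def Y_trees_def)
    then show "p \<in> ?X"
      by (auto simp: p of_tree_def)
  qed
  then have card: "card ?X = below ?U"
    by (simp add: below_def card_image inj_on_def)
  have "(Phi ?U :: 'a) = (\<Sum>a\<in>?X. (case a of (S, T) \<Rightarrow> of_tree T) ?U)"
    by (simp add: Phi_def formal_sum_def)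
  also have "\<dots> = (\<Sum>a\<in>?X. 1)"
    by (rule sum.cong) (auto simp: of_tree_def split: if_splits)
  finally have "Phi ?U = (of_nat (below ?U) :: 'a)"
    using card by simp
  then show "below_series ?U = of_tree Triv ?U + (Phi ?U :: 'a)"
    by (simp add: below_series_def of_tree_def)
qed

lemma Phi_eq_vee: "Phi = vee (star below_series below_series) below_series"
proof (rule series_eqI)
  fix L R
  have "Phi (Vee L R) = (below_series (Vee L R) :: 'a)"
    by (simp add: below_series_eq_unit_plus_Phi of_tree_def)
  also have "\<dots> = star below_series below_series L * below_series R"
    by (simp add: below_series_def below_Vee star_coeff case_prod_unfold)
  finally show "Phi (Vee L R) = (vee (star below_series below_series) below_series (Vee L R) :: 'a)"
    by simp
qed (simp add: Phi_Triv)

lemma star_sign_series: "star sign_series sign_series U = (- 1) ^ nodes U * of_nat (nodes U + 1)"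
proof -
  have "star sign_series sign_series U = (\<Sum>p\<in>splits U. (- 1) ^ nodes U)"
    unfolding star_coeff sign_series_def
    by (rule sum.cong) (auto simp: power_add[symmetric] dest: splits_nodes)
  then show ?thesis
    by (simp add: card_splits mult.commute)
qed

lemma Delta_eq_vee: "Delta = vee (star sign_series sign_series) sign_series"
proof (rule series_eqI)
  have False if "Delta Triv \<noteq> (0 :: 'a)"
    using formal_sum_nonzeroD[OF that[unfolded Delta_def]]
    by (auto simp: smult_series_def dest: of_tree_nonzeroD)
  then show "Delta Triv = (vee (star sign_series sign_series) sign_series Triv :: 'a)"
    by auto
next
  fix L R
  let ?f = "\<lambda>a. (case a of (T1, T2) \<Rightarrow> smult_series
      ((- 1) ^ (nodes T1 + nodes T2) * of_nat (nodes T1 + 1)) (of_tree (Vee T1 T2))) (Vee L R) :: 'a"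
  have "Delta (Vee L R) = (\<Sum>a | ?f a \<noteq> 0. ?f a)"
    by (simp add: Delta_def formal_sum_def)
  also have "\<dots> = (\<Sum>a\<in>{(L, R)}. ?f a)"
    by (rule sum.mono_neutral_left) (auto simp: smult_series_def of_tree_def split: if_splits)
  also have "\<dots> = star sign_series sign_series L * sign_series R"
    unfolding star_sign_series
    by (simp add: smult_series_def of_tree_def sign_series_def power_add ac_simps)
  finally show "Delta (Vee L R) = (vee (star sign_series sign_series) sign_series (Vee L R) :: 'a)"
    by simp
qed

text \<open>This is the geometric series: the power of \<open>Y\<close> with exponent \<open>n\<close> for the associative product is the
  sum of all trees with \<open>n\<close> vertices, so the sign series is \<open>1 - Y + Y * Y - \<dots>\<close>. The proof compares
  coefficients: at \<open>L \<or> R\<close> the cuts through \<open>R\<close> contribute \<open>- A L\<close> times the coefficient at \<open>R\<close>, which is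
  known by induction. If \<open>R\<close> is nontrivial, this vanishes, and so do the contributions of the cuts
  through \<open>L\<close>; if \<open>R\<close> is trivial, these contributions are \<open>A L\<close> and the two cancel.\<close>

lemma star_sign_unit_plus_Y: "star sign_series unit_plus_Y = of_tree Triv"
proof
  fix U
  show "star sign_series unit_plus_Y U = (of_tree Triv U :: 'a)"
  proof (induction U)
    case (Vee L R)
    have "(\<lambda>T. unit_plus_Y (Vee T R)) = (\<lambda>T. of_tree Triv T * of_tree Triv R :: 'a)"
      by (auto simp: unit_plus_Y_def of_tree_def)
    moreover have "(\<lambda>S. sign_series (Vee L S)) = (\<lambda>S. - sign_series L * sign_series S :: 'a)"
      by (simp add: sign_series_def power_add)
    ultimately show ?case
      unfolding star_Vee by (simp only: star_scale_left star_scale_right' star_unit_right Vee.IH)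
         (simp add: of_tree_def)
  qed (simp add: sign_series_def unit_plus_Y_def of_tree_def)
qed

lemma star_unit_plus_Y_sign: "star unit_plus_Y sign_series = of_tree Triv"
proof
  fix U
  show "star unit_plus_Y sign_series U = (of_tree Triv U :: 'a)"
  proof (induction U)
    case (Vee L R)
    have "(\<lambda>T. unit_plus_Y (Vee L T)) = (\<lambda>T. of_tree Triv L * of_tree Triv T :: 'a)"
      by (auto simp: unit_plus_Y_def of_tree_def)
    moreover have "(\<lambda>S. sign_series (Vee S R)) = (\<lambda>S. sign_series S * - sign_series R :: 'a)"
      by (simp add: sign_series_def power_add)
    ultimately show ?case
      unfolding star_Vee by (simp only: star_scale_left star_scale_right' star_unit_left Vee.IH)
         (simp add: of_tree_def)
  qed (simp add: sign_series_def unit_plus_Y_def of_tree_def)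
qed

text \<open>The identity \<open>F \<succ> (P \<succ> Y \<prec> Q) \<prec> G = (F * P) \<succ> Y \<prec> (Q * G)\<close>, with \<open>\<succ> Y \<prec>\<close> written as \<open>\<or>\<close>.\<close>

lemma dend_succ_prec_vee: "dend_succ F (dend_prec (vee P Q) G) = vee (star F P) (star Q G)"
  by (rule series_eqI) (simp_all add: dend_succ_Vee dend_prec_Vee star_scale_left star_scale_right')

lemma vee_unit_unit: "vee (of_tree Triv) (of_tree Triv) = of_tree Y_tree"
  by (rule series_eqI) (simp_all add: of_tree_def)

lemma star_cancel_middle:
  assumes "star Q R = of_tree Triv"
  shows "star (star P Q) (star R S) = star P S"
proof -
  have "star (star P Q) (star R S) = star P (star (star Q R) S)"
    by (simp only: star_assoc)
  then show ?thesis
    by (simp add: assms)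
qed

lemma series_subst_Phi_Delta: "series_subst Phi (Delta :: 'k::field series) = of_tree Y_tree"
proof -
  define a where "a = series_subst Phi (sign_series :: 'k series)"
  have b: "below_series = series_subst Phi (unit_plus_Y :: 'k series)"
    unfolding unit_plus_Y_def[abs_def] series_subst_add
    by (simp add: series_subst_unit series_subst_Y Phi_Triv below_series_eq_unit_plus_Phi)
  have a: "star a below_series = of_tree Triv" "star below_series a = of_tree Triv"
    unfolding a_def b series_subst_star[of Phi, OF Phi_Triv, symmetric]
      star_sign_unit_plus_Y star_unit_plus_Y_sign
    by (rule series_subst_unit[of Phi, OF Phi_Triv])+
  have "series_subst Phi (Delta :: 'k series) = dend_succ (star a a) (dend_prec Phi a)"
    by (simp add: Delta_eq_vee series_subst_vee series_subst_star Phi_Triv a_def)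
  also have "\<dots> = vee (star (star a a) (star below_series below_series)) (star below_series a)"
    by (subst Phi_eq_vee) (rule dend_succ_prec_vee)
  also have "\<dots> = of_tree Y_tree"
    by (simp add: star_cancel_middle a vee_unit_unit)
  finally show ?thesis .
qed

lemma Delta_Triv: "Delta Triv = 0"
  by (simp add: Delta_eq_vee)

lemma series_subst_Phi:
  assumes "H Triv = 0"
  defines "x \<equiv> series_subst H below_series"
  shows "series_subst H Phi = dend_succ (star x x) (dend_prec H x)"
    and "x = (\<lambda>U. of_tree Triv U + series_subst H Phi U)"
proof -
  show "series_subst H Phi = dend_succ (star x x) (dend_prec H x)"
    unfolding x_def by (subst Phi_eq_vee) (simp add: series_subst_vee series_subst_star assms(1))
  show "x = (\<lambda>U. of_tree Triv U + series_subst H Phi U)"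
    unfolding x_def below_series_eq_unit_plus_Phi series_subst_add
    by (simp add: series_subst_unit assms(1))
qed

lemma series_subst_Delta_Phi: "series_subst (Delta :: 'k::field series) Phi = of_tree Y_tree"
proof -
  define x where "x = series_subst Delta (below_series :: 'k series)"
  let ?s = "sign_series :: 'k series" and ?j = "unit_plus_Y :: 'k series"
  have Phi: "series_subst (Delta :: 'k series) Phi = vee (star (star x x) (star ?s ?s)) (star ?s x)"
    unfolding series_subst_Phi(1)[of Delta, OF Delta_Triv] x_def
    by (subst (2) Delta_eq_vee) (rule dend_succ_prec_vee)
  have x: "x U = of_tree Triv U + vee (star (star x x) (star ?s ?s)) (star ?s x) U" for U
    using fun_cong[OF series_subst_Phi(2)[of "Delta :: 'k series", OF Delta_Triv], of U]
    unfolding Phi x_def[symmetric] .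
  have vee_j: "vee (star (star ?j ?j) (star ?s ?s)) (star ?s ?j) = of_tree Y_tree"
    by (simp add: star_cancel_middle star_sign_unit_plus_Y star_unit_plus_Y_sign vee_unit_unit)
  have j: "?j U = of_tree Triv U + vee (star (star ?j ?j) (star ?s ?s)) (star ?s ?j) U" for U
    unfolding vee_j by (rule unit_plus_Y_def)
  \<comment> \<open>The same equation holds for both; at \<open>L \<or> R\<close> its right-hand side involves only trees of the
    size of \<open>L\<close> or \<open>R\<close> or smaller.\<close>
  have "x U = ?j U" for U
  proof (induction "nodes U" arbitrary: U rule: less_induct)
    case less
    show ?case
    proof (cases U)
      case Triv
      then show ?thesis
        using x[of Triv] by (simp add: unit_plus_Y_def of_tree_def)
    next
      case U: (Vee L R)
      have L: "star (star x x) (star ?s ?s) L = star (star ?j ?j) (star ?s ?s) L"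
        by (intro star_cong refl less) (simp_all add: U)
      have R: "star ?s x R = star ?s ?j R"
        by (intro star_cong refl less) (simp_all add: U)
      have "x U = star (star x x) (star ?s ?s) L * star ?s x R"
        using x[of U] by (simp add: U of_tree_def)
      also have "\<dots> = ?j U"
        using j[of U] by (simp add: L R U of_tree_def)
      finally show ?thesis .
    qed
  qed
  then have "x = ?j" ..
  with Phi vee_j show ?thesis
    by simp
qed

text \<open>The functional equation of \<open>\<Phi>\<close> reads \<open>Y = ((1 + Y) * (1 + Y)) \<succ> H \<prec> (1 + Y)\<close> in this case, and the
  two factors around \<open>H\<close> are invertible. Moving
  them to the other side expresses \<open>H\<close> explicitly.\<close>

lemma series_subst_Phi_eq_Y_imp:
  assumes "H Triv = 0" "series_subst H Phi = of_tree Y_tree"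
  shows "H = Delta"
proof -
  let ?s = "sign_series :: 'a series" and ?j = "unit_plus_Y :: 'a series"
  have x: "series_subst H below_series = ?j"
    unfolding series_subst_Phi(2)[of H, OF assms(1)] assms(2) unit_plus_Y_def[abs_def] ..
  have "dend_succ (star ?j ?j) (dend_prec H ?j) = vee (of_tree Triv) (of_tree Triv)"
    using series_subst_Phi(1)[of H, OF assms(1)] assms(2) by (simp add: x vee_unit_unit)
  then have "Delta = dend_succ (star ?s ?s) (dend_prec (dend_succ (star ?j ?j) (dend_prec H ?j)) ?s)"
    by (simp add: dend_succ_prec_vee Delta_eq_vee)
  also have "dend_succ (star ?s ?s) (dend_prec (dend_succ (star ?j ?j) (dend_prec H ?j)) ?s) = H"
    by (simp add: dend_prec_succ dend_succ_succ dend_prec_prec star_cancel_middle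
        star_sign_unit_plus_Y star_unit_plus_Y_sign assms(1))
  finally show ?thesis ..
qed

theorem proposition7p3:
  shows "(Phi :: 'k::field series) \<in> carrier G_Dend
    \<and> (Delta :: 'k series) \<in> carrier G_Dend
    \<and> (Phi :: 'k series) \<otimes>\<^bsub>G_Dend\<^esub> Delta = \<one>\<^bsub>G_Dend\<^esub>
    \<and> (Delta :: 'k series) \<otimes>\<^bsub>G_Dend\<^esub> Phi = \<one>\<^bsub>G_Dend\<^esub>
    \<and> inv\<^bsub>G_Dend\<^esub> (Phi :: 'k series) = Delta"
proof -
  have Phi: "(Phi :: 'k series) \<in> carrier G_Dend"
    by (simp add: G_Dend_def Phi_Triv) (simp add: Phi_eq_vee below_series_def below_Triv)
  have Delta: "(Delta :: 'k series) \<in> carrier G_Dend"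
    by (simp add: G_Dend_def Delta_eq_vee sign_series_def)
  have right: "(Phi :: 'k series) \<otimes>\<^bsub>G_Dend\<^esub> Delta = \<one>\<^bsub>G_Dend\<^esub>"
    by (simp add: G_Dend_def dend_comp_eq_series_subst Phi_Triv Delta_Triv series_subst_Delta_Phi)
  have left: "(Delta :: 'k series) \<otimes>\<^bsub>G_Dend\<^esub> Phi = \<one>\<^bsub>G_Dend\<^esub>"
    by (simp add: G_Dend_def dend_comp_eq_series_subst Phi_Triv Delta_Triv series_subst_Phi_Delta)
  have "inv\<^bsub>G_Dend\<^esub> (Phi :: 'k series) = Delta"
    unfolding m_inv_def
  proof (rule the_equality)
    fix H assume "H \<in> carrier G_Dend \<and> (Phi :: 'k series) \<otimes>\<^bsub>G_Dend\<^esub> H = \<one>\<^bsub>G_Dend\<^esub>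
      \<and> H \<otimes>\<^bsub>G_Dend\<^esub> Phi = \<one>\<^bsub>G_Dend\<^esub>"
    then have "H Triv = 0" "dend_comp Phi H = of_tree Y_tree"
      by (simp_all add: G_Dend_def)
    then have "H Triv = 0" "series_subst H Phi = of_tree Y_tree"
      by (simp_all add: dend_comp_eq_series_subst Phi_Triv)
    then show "H = Delta"
      by (rule series_subst_Phi_eq_Y_imp)
  qed (use Delta left right in blast)
  with Phi Delta left right show ?thesis
    by blast
qed

end
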